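(* Let $p$ be an odd prime and let $G$ be a $p$-group of order $p^{\lambda}$. If $G$ is not isomorphic to the cyclic group $C_{p^{\lambda}}$, then $$\lvert \mathfrak{s}(G)\rvert \geq (p+1)(\lambda-1)+2,$$ with equality if and only if $G \cong C_{p^{\lambda-1}} \times C_p$ or $G \cong M_{p^{\lambda}}$, where $$M_{p^{\lambda}} = \left\langle a,b \mid a^{p^{\lambda-1}} = b^p = 1,\ a^b = a^{1+p^{\lambda-2}} \right\rangle.$$
   Context: For a finite group $G$, $\mathfrak{s}(G)$ denotes the set of all subgroups of $G$ (including the trivial subgroup and $G$ itself), so $\lvert\mathfrak{s}(G)\rvert$ is the total number of subgroups of $G$. $C_n$ denotes the cyclic group of order $n$. In presentations, $a^b = b^{-1}ab$. (The non-cyclicity of $G$ forces $\lambda \geq 2$, so the exponents above make sense.) *)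

theory Defs
  imports "HOL-Algebra.Algebra" "HOL-Computational_Algebra.Primes"
begin

definition subgroups_of :: "('a, 'b) monoid_scheme \<Rightarrow> 'a set set" where
  "subgroups_of G = {H. subgroup H G}"

text \<open>
  Groups given by generators and relations. The generators are all elements of the type
  \<open>'x\<close>. The letter \<open>(x, True)\<close> stands for \<open>x\<close> and \<open>(x, False)\<close> for its inverse.
  A relation \<open>u = v\<close> is the pair \<open>(u, v)\<close>. The presented group consists of the words modulo
  the least congruence that contains the free cancellations and the given relations, that is,
  it is the free group modulo the normal closure of the relators.
\<close>

type_synonym 'x word = "('x \<times> bool) list"

inductive word_eq :: "('x word \<times> 'x word) set \<Rightarrow> 'x word \<Rightarrow> 'x word \<Rightarrow> bool"
  for R :: "('x word \<times> 'x word) set" where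
  word_eq_refl: "word_eq R u u"
| word_eq_sym: "word_eq R u v \<Longrightarrow> word_eq R v u"
| word_eq_trans: "word_eq R u v \<Longrightarrow> word_eq R v w \<Longrightarrow> word_eq R u w"
| word_eq_append: "word_eq R u u' \<Longrightarrow> word_eq R v v' \<Longrightarrow> word_eq R (u @ v) (u' @ v')"
| word_eq_cancel: "word_eq R [(x, s), (x, \<not> s)] []"
| word_eq_rel: "(u, v) \<in> R \<Longrightarrow> word_eq R u v"

definition word_class :: "('x word \<times> 'x word) set \<Rightarrow> 'x word \<Rightarrow> 'x word set" where
  "word_class R u = {v. word_eq R u v}"

definition presented_group :: "('x word \<times> 'x word) set \<Rightarrow> 'x word set monoid" where
  "presented_group R =
    \<lparr>carrier = range (word_class R),
     monoid.mult = (\<lambda>A B. \<Union>u\<in>A. \<Union>v\<in>B. word_class R (u @ v)),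
     one = word_class R []\<rparr>"

datatype gen_ab = Gen_a | Gen_b

abbreviation gen_pow :: "'x \<Rightarrow> nat \<Rightarrow> 'x word" where
  "gen_pow x n \<equiv> replicate n (x, True)"

text \<open>
  The last relation is \<open>a\<^sup>b = a\<^bsup>1 + p^(n-2)\<^esup>\<close> with \<open>a\<^sup>b = b\<^sup>-\<^sup>1 a b\<close>. The subtractions are
  truncated, so the definition has its intended meaning for \<open>n \<ge> 2\<close> only.
\<close>

definition modular_rels :: "nat \<Rightarrow> nat \<Rightarrow> (gen_ab word \<times> gen_ab word) set" where
  "modular_rels p n =
    {(gen_pow Gen_a (p ^ (n - 1)), []),
     (gen_pow Gen_b p, []),
     ([(Gen_b, False), (Gen_a, True), (Gen_b, True)], gen_pow Gen_a (1 + p ^ (n - 2)))}"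

definition modular_group :: "nat \<Rightarrow> nat \<Rightarrow> gen_ab word set monoid" where
  "modular_group p n = presented_group (modular_rels p n)"

lemma word_class_eq_iff: "word_class R u = word_class R v \<longleftrightarrow> word_eq R u v"
  unfolding word_class_def
  by (metis (no_types, lifting) Collect_cong mem_Collect_eq word_eq_refl word_eq_sym word_eq_trans)

lemma carrier_presented_group: "carrier (presented_group R) = range (word_class R)"
  by (simp add: presented_group_def)

lemma one_presented_group: "\<one>\<^bsub>presented_group R\<^esub> = word_class R []"
  by (simp add: presented_group_def)

lemma mult_presented_group:
  "word_class R u \<otimes>\<^bsub>presented_group R\<^esub> word_class R v = word_class R (u @ v)"
proof -
  have "word_class R (u' @ v') = word_class R (u @ v)"
    if "u' \<in> word_class R u" "v' \<in> word_class R v" for u' v'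
    using that unfolding word_class_eq_iff
    by (simp add: word_class_def word_eq_append word_eq_sym)
  moreover have "u \<in> word_class R u" "v \<in> word_class R v"
    by (simp_all add: word_class_def word_eq_refl)
  ultimately have "(\<Union>u'\<in>word_class R u. \<Union>v'\<in>word_class R v. word_class R (u' @ v')) =
      word_class R (u @ v)"
    by blast
  then show ?thesis
    by (simp add: presented_group_def)
qed

definition word_inv :: "'x word \<Rightarrow> 'x word" where
  "word_inv u = rev (map (\<lambda>(x, s). (x, \<not> s)) u)"

lemma word_eq_inv_left: "word_eq R (word_inv u @ u) []"
proof (induction u)
  case Nil
  show ?case by (simp add: word_inv_def word_eq_refl)
next
  case (Cons l u)
  obtain x s where l: "l = (x, s)" by fastforce
  have "word_eq R ([(x, \<not> s), (x, s)] @ u) ([] @ u)"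
    using word_eq_cancel[of R x "\<not> s"] by (intro word_eq_append word_eq_refl) simp
  then have "word_eq R (word_inv u @ ([(x, \<not> s), (x, s)] @ u)) (word_inv u @ u)"
    by (intro word_eq_append word_eq_refl) simp
  then have "word_eq R (word_inv (l # u) @ (l # u)) (word_inv u @ u)"
    by (simp add: word_inv_def l)
  then show ?case using Cons.IH by (rule word_eq_trans)
qed

lemma group_presented_group: "group (presented_group R)"
proof (rule groupI)
  fix x assume "x \<in> carrier (presented_group R)"
  then obtain u where "x = word_class R u" by (auto simp: carrier_presented_group)
  then show "\<exists>y\<in>carrier (presented_group R). y \<otimes>\<^bsub>presented_group R\<^esub> x = \<one>\<^bsub>presented_group R\<^esub>"
    by (intro bexI[of _ "word_class R (word_inv u)"])
       (auto simp: carrier_presented_group one_presented_group mult_presented_group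
          word_class_eq_iff word_eq_inv_left)
qed (auto simp: carrier_presented_group one_presented_group mult_presented_group)

fun word_eval :: "('a, 'b) monoid_scheme \<Rightarrow> ('x \<Rightarrow> 'a) \<Rightarrow> 'x word \<Rightarrow> 'a" where
  "word_eval H f [] = \<one>\<^bsub>H\<^esub>"
| "word_eval H f ((x, s) # u) = (if s then f x else inv\<^bsub>H\<^esub> (f x)) \<otimes>\<^bsub>H\<^esub> word_eval H f u"

text \<open>Von Dyck's theorem: the universal property of the presented group.\<close>

lemma presented_group_hom_exists:
  assumes "group H" and f: "\<And>x. f x \<in> carrier H"
    and rel: "\<And>u v. (u, v) \<in> R \<Longrightarrow> word_eval H f u = word_eval H f v"
  shows "\<exists>h\<in>hom (presented_group R) H. \<forall>u. h (word_class R u) = word_eval H f u"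
proof -
  interpret group H by fact
  have cl: "word_eval H f u \<in> carrier H" for u
    by (induction u) (auto simp: f)
  have app: "word_eval H f (u @ v) = word_eval H f u \<otimes>\<^bsub>H\<^esub> word_eval H f v" for u v
    by (induction u) (auto simp: f cl m_assoc)
  have eq: "word_eval H f u = word_eval H f v" if "word_eq R u v" for u v
    using that by induction (auto simp: f app rel)
  define h where "h A = word_eval H f (SOME u. u \<in> A)" for A
  have h: "h (word_class R u) = word_eval H f u" for u
  proof -
    have "(SOME v. v \<in> word_class R u) \<in> word_class R u"
      by (rule someI[of _ u]) (simp add: word_class_def word_eq_refl)
    then show ?thesis
      unfolding h_def by (metis eq mem_Collect_eq word_class_def)
  qed
  have "h \<in> hom (presented_group R) H"
    by (rule homI) (auto simp: carrier_presented_group mult_presented_group h cl app)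
  then show ?thesis using h by blast
qed

end

(*
Let Z be a central subgroup of order p. The subgroups of G that contain Z correspond to the
subgroups of G/Z, so the bound follows by induction on n once at least p + 1 subgroups avoid Z.
Since p is odd and G is not cyclic, there is an h outside Z = <z> with h^p = 1; the trivial
subgroup and the p subgroups <h z^i> are p + 1 subgroups that avoid Z.
Equality holds iff G has an element a of order p^(n-1). If there is one, then G is the semidirect
product of <a> with some <b> of order p, where b maps a to a^r with r = 1 modulo p^(n-2);
then exactly p + 1 subgroups avoid z = a^(p^(n-2)), and G/<z> has the same shape. If there is
none and the induction hypothesis is sharp for G/Z, then a lift of an element of order p^(n-2)
generates one more subgroup that avoids Z (for n = 3 the exponent of G is p, and elements outside
<h, z> do so).
The number r decides between the two groups of the theorem: r = 1 gives the direct product, and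
otherwise replacing b by a power makes r = 1 + p^(n-2).
*)

theory Submission
  imports Defs "HOL-Number_Theory.Residues"
begin

section \<open>Arithmetic\<close>

text \<open>The choice of Z matters: dividing C_(p^(n-1)) x C_p by its second factor leaves a cyclic
  group, about which the induction hypothesis says nothing. So the proof branches first on the
  existence of an element \<open>a\<close> of order p^(n-1). If there is one, Z is taken inside <a>
  and both counts are exact. If there is none, the exponent of G divides p^(n-2), and G/Z is
  noncyclic for every central Z of order p. Oddness enters through one computation: if r = 1 modulo
  p, then 1 + r + ... + r^(p-1) is divisible by p exactly once, because p (p-1) / 2 is a multiple of
  p. This is what makes G split over <a>, and it also yields h: a maximal subgroup is either cyclic,
  so that G splits, or a smaller noncyclic group. The quaternion group of order 8, with its single
  involution, is the obstacle for p = 2. The order of the presented group is never computed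
  outright. Its relations give an upper bound, and a group G of order p^n that it maps onto, or is
  isomorphic to, supplies the rest.\<close>

lemma dvd_one_plus_pow:
  fixes x :: int
  shows "x\<^sup>2 dvd (1 + x) ^ i - (1 + of_nat i * x)"
proof (induction i)
  case (Suc i)
  have "(1 + x) ^ Suc i - (1 + of_nat (Suc i) * x) =
      (1 + x) * ((1 + x) ^ i - (1 + of_nat i * x)) + of_nat i * x\<^sup>2"
    by (simp add: algebra_simps power2_eq_square)
  then show ?case using Suc.IH by simp
qed simp

text \<open>With \<open>r = 1 + x\<close>, the terms of degree at least 2 in \<open>x\<close> vanish
  because \<open>u * p\<close> divides \<open>x^2\<close>. What remains is
  \<open>p + x * p * (p - 1) / 2\<close>, where \<open>(p - 1) / 2\<close> is an integer for odd
  \<open>p\<close>. For \<open>p = u = 2\<close> and \<open>r = 3\<close> the sum is 4, which is not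
  2 modulo 4.\<close>

lemma cong_sum_powers:
  fixes p u r :: nat
  assumes "odd p" "p dvd u" "[r = 1] (mod u)"
  shows "[(\<Sum>i<p. r ^ i) = p] (mod u * p)"
proof -
  define x where "x = int r - 1"
  have r: "int r = 1 + x" and ux: "int u dvd x"
    using assms(3) by (simp_all add: x_def cong_iff_dvd_diff[of "int r"] flip: cong_int_iff)
  have up: "int (u * p) dvd x\<^sup>2"
    using assms(2) ux unfolding power2_eq_square of_nat_mult
    by (meson dvd_trans mult_dvd_mono of_nat_dvd_iff)
  have "int (\<Sum>i<p. r ^ i) - (\<Sum>i<p. 1 + int i * x) =
      (\<Sum>i<p. (1 + x) ^ i - (1 + int i * x))"
    by (simp add: r sum_subtractf)
  moreover have "int (u * p) dvd \<dots>"
    by (intro dvd_sum dvd_trans[OF up dvd_one_plus_pow])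
  moreover have "(\<Sum>i<p. 1 + int i * x) = int p + int (p * ((p - 1) div 2)) * x"
  proof -
    have "(\<Sum>i<p. int i) = int (\<Sum>i<p. i)" by simp
    also have "(\<Sum>i<p. i) = p * (p - 1) div 2"
      using gauss_sum_nat[of "p - 1"] odd_pos[OF assms(1)]
      by (metis One_nat_def Suc_pred atLeast0AtMost lessThan_Suc_atMost mult.commute)
    also have "\<dots> = p * ((p - 1) div 2)"
      using assms(1) by (simp add: div_mult_swap)
    finally show ?thesis
      by (simp add: sum.distrib flip: sum_distrib_right)
  qed
  moreover have "int (u * p) dvd int (p * ((p - 1) div 2)) * x"
    using ux by (simp add: mult.commute mult.left_commute mult_dvd_mono dvd_mult)
  ultimately have "int (u * p) dvd (int (\<Sum>i<p. r ^ i) - (int p + y)) + y"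
      if "y = int (p * ((p - 1) div 2)) * x" for y
    using that by (intro dvd_add) simp_all
  then have "int (u * p) dvd int (\<Sum>i<p. r ^ i) - int p"
    by (simp add: algebra_simps)
  then show ?thesis
    unfolding cong_int_iff[symmetric] cong_iff_dvd_diff .
qed

text \<open>Fermat's theorem gives the congruence modulo \<open>p\<close>. In the factorization of
  \<open>r ^ p - 1\<close> into \<open>r - 1\<close> and the sum of the powers of \<open>r\<close>,
  the sum is then divisible by \<open>p\<close> exactly once, so \<open>r - 1\<close> keeps all but
  one of the factors \<open>p\<close>.\<close>

lemma cong_prime_power_root:
  fixes p r m :: nat
  assumes p: "Factorial_Ring.prime p" "odd p" and r: "[r ^ p = 1] (mod p ^ Suc m)"
  shows "[r = 1] (mod p)" "[r = 1] (mod p ^ m)"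
proof -
  have rp: "[r ^ p = 1] (mod p)"
    using r by (rule cong_dvd_modulus_nat) simp
  have "\<not> p dvd r"
  proof
    assume "p dvd r"
    then have "p dvd r ^ p" using odd_pos[OF p(2)] by (meson dvd_power dvd_trans)
    then have "p dvd 1" using rp cong_dvd_iff by blast
    then show False using p(1) by simp
  qed
  then have "[r * r ^ (p - 1) = r * 1] (mod p)"
    using fermat_theorem[OF p(1)] by (intro cong_mult) auto
  then have "[r ^ p = r] (mod p)"
    using odd_pos[OF p(2)] by (simp add: power_eq_if)
  then show r1: "[r = 1] (mod p)"
    using rp by (metis cong_sym cong_trans)
  define x where "x = int r - 1"
  have S: "[(\<Sum>i<p. r ^ i) = p] (mod p * p)"
    by (rule cong_sum_powers) (use p r1 in auto)
  then obtain q where q: "int (\<Sum>i<p. r ^ i) = int p * (1 + int p * q)"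
  proof -
    have "int p * int p dvd int (\<Sum>i<p. r ^ i) - int p"
      using S unfolding cong_int_iff[symmetric] cong_iff_dvd_diff by simp
    then obtain q where "int (\<Sum>i<p. r ^ i) - int p = int p * int p * q" ..
    then have "int (\<Sum>i<p. r ^ i) = int p * (1 + int p * q)"
      by (simp add: algebra_simps)
    then show ?thesis by (rule that)
  qed
  have "int p * int p ^ m dvd int r ^ p - 1"
    using r unfolding cong_int_iff[symmetric] cong_iff_dvd_diff by simp
  also have "int r ^ p - 1 = x * int (\<Sum>i<p. r ^ i)"
    by (simp add: x_def power_diff_1_eq)
  also have "\<dots> = int p * (x * (1 + int p * q))"
    by (simp only: q mult.left_commute)
  finally have "int p ^ m dvd x * (1 + int p * q)"
    using odd_pos[OF p(2)] by simp
  moreover have "coprime (int p ^ m) (1 + int p * q)"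
  proof -
    have "coprime (int p) (1 + int p * q)"
      by (rule coprimeI) (metis dvd_add_left_iff dvd_trans dvd_triv_left)
    then show ?thesis by simp
  qed
  ultimately have "int p ^ m dvd x"
    by (simp add: coprime_dvd_mult_left_iff)
  then show "[r = 1] (mod p ^ m)"
    unfolding cong_int_iff[symmetric] cong_iff_dvd_diff by (simp add: x_def)
qed

lemma cong_one_plus_pow:
  fixes x s :: nat
  assumes "u dvd x\<^sup>2"
  shows "[(1 + x) ^ s = 1 + s * x] (mod u)"
proof -
  have "int u dvd int (x\<^sup>2)"
    using assms by (simp only: of_nat_dvd_iff)
  then have "int u dvd int ((1 + x) ^ s) - int (1 + s * x)"
    using dvd_trans[OF _ dvd_one_plus_pow[of "int x" s]] by simp
  then show ?thesis
    unfolding cong_int_iff[symmetric] cong_iff_dvd_diff .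
qed

text \<open>\<open>k\<close> is a power of \<open>p\<close> below \<open>p ^ N\<close> times a unit;
  inverting the unit and supplying the missing power of \<open>p\<close> gives \<open>s\<close>. For
  a cyclic group of order \<open>p ^ N\<close> this says that every nontrivial subgroup contains the
  one of order \<open>p\<close>.\<close>

lemma prime_power_multiple_unit:
  fixes p N k :: nat
  assumes p: "Factorial_Ring.prime p" and N: "0 < N" and k: "\<not> p ^ N dvd k"
  obtains s where "[k * s = p ^ (N - 1)] (mod p ^ N)"
proof -
  have k0: "k \<noteq> 0" using k by (metis dvd_0_right)
  define e where "e = multiplicity p k"
  obtain m where m: "k = p ^ e * m" "\<not> p dvd m"
    using multiplicity_decompose'[of k p] k0 p unfolding e_def
    by (metis not_prime_unit)
  have e: "e < N"
    using k m(1) by (meson dvd_mult2 le_imp_power_dvd not_less)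
  have "coprime m (p ^ N)"
    using prime_imp_coprime[OF p m(2)] by (simp add: coprime_commute)
  then obtain t where "[m * t = 1] (mod p ^ N)"
    using cong_solve_coprime_nat[of m "p ^ N"] by (metis One_nat_def)
  then have "[p ^ (N - 1) * (m * t) = p ^ (N - 1) * 1] (mod p ^ N)"
    by (rule cong_scalar_left)
  moreover have "p ^ (N - 1) = p ^ e * p ^ (N - 1 - e)"
    using e by (simp flip: power_add)
  ultimately have "[k * (p ^ (N - 1 - e) * t) = p ^ (N - 1)] (mod p ^ N)"
    by (simp add: m(1) ac_simps)
  then show ?thesis by (rule that)
qed

section \<open>Powers and subgroups of finite groups\<close>

context group
begin

lemma pow_cong:
  fixes k l N :: nat
  assumes "x \<in> carrier G" "x [^] N = \<one>" "[k = l] (mod N)"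
  shows "x [^] k = x [^] l"
proof -
  have "int (ord x) dvd int l - int k"
  proof -
    have "ord x dvd N" using assms(1,2) by (simp add: pow_eq_id)
    then have "[l = k] (mod ord x)" using assms(3) by (meson cong_dvd_modulus_nat cong_sym)
    then show ?thesis unfolding cong_int_iff[symmetric] cong_iff_dvd_diff .
  qed
  then show ?thesis
    using int_pow_eq[OF assms(1), of "int k" "int l"] by (simp add: int_pow_int)
qed

lemma pow_eq_iff_cong:
  fixes k l :: nat
  assumes "x \<in> carrier G"
  shows "x [^] k = x [^] l \<longleftrightarrow> [k = l] (mod ord x)"
proof -
  have "x [^] k = x [^] l \<longleftrightarrow> int (ord x) dvd int l - int k"
    using int_pow_eq[OF assms, of "int k" "int l"] by (simp add: int_pow_int)
  also have "\<dots> \<longleftrightarrow> [k = l] (mod ord x)"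
    unfolding cong_int_iff[symmetric] cong_iff_dvd_diff by (rule dvd_diff_commute)
  finally show ?thesis .
qed

lemma mem_generate_singleton:
  assumes "finite (carrier G)" "a \<in> carrier G"
  shows "x \<in> generate G {a} \<longleftrightarrow> (\<exists>k::nat. x = a [^] k)"
  using generate_pow_on_finite_carrier[OF assms] by auto

lemma pow_prime_power_ord:
  assumes p: "Factorial_Ring.prime p" and x: "x \<in> carrier G"
    and "x [^] p ^ m = \<one>" "0 < m" "x [^] p ^ (m - 1) \<noteq> \<one>"
  shows "ord x = p ^ m"
proof -
  have "ord x dvd p ^ m" and *: "\<not> ord x dvd p ^ (m - 1)"
    using assms by (auto simp: pow_eq_id)
  then obtain i where i: "i \<le> m" "ord x = p ^ i"
    using divides_primepow_nat[OF p] by blast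
  moreover have "\<not> i \<le> m - 1"
    using * i(2) le_imp_power_dvd by metis
  ultimately have "i = m" by simp
  then show ?thesis using i by simp
qed

lemma conj_pow:
  fixes k :: nat
  assumes "c \<in> carrier G" "x \<in> carrier G"
  shows "(c \<otimes> x \<otimes> inv c) [^] k = c \<otimes> x [^] k \<otimes> inv c"
proof (induction k)
  case (Suc k)
  have "(c \<otimes> x \<otimes> inv c) [^] Suc k = c \<otimes> x [^] k \<otimes> (inv c \<otimes> (c \<otimes> (x \<otimes> inv c)))"
    using assms unfolding nat_pow_Suc Suc.IH by (simp add: m_assoc)
  also have "inv c \<otimes> (c \<otimes> (x \<otimes> inv c)) = x \<otimes> inv c"
    using assms by (simp add: m_assoc[symmetric])
  also have "c \<otimes> x [^] k \<otimes> (x \<otimes> inv c) = c \<otimes> x [^] Suc k \<otimes> inv c"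
    using assms by (simp add: m_assoc)
  finally show ?case .
qed (use assms in simp)

section \<open>Products of powers under the relation
  \<open>a \<otimes> c = c \<otimes> a [^] r\<close>\<close>

lemma pow_mult_swap:
  fixes k m r :: nat
  assumes a: "a \<in> carrier G" and c: "c \<in> carrier G" and ac: "a \<otimes> c = c \<otimes> a [^] r"
  shows "a [^] k \<otimes> c [^] m = c [^] m \<otimes> a [^] (k * r ^ m)"
proof -
  have 1: "a [^] k \<otimes> c = c \<otimes> a [^] (k * r)" for k :: nat
  proof (induction k)
    case (Suc k)
    have "a [^] Suc k \<otimes> c = (a [^] k \<otimes> c) \<otimes> a [^] r"
      using a c by (simp add: m_assoc ac)
    also have "\<dots> = c \<otimes> a [^] (Suc k * r)"
      using a c by (simp add: Suc.IH m_assoc nat_pow_mult add.commute)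
    finally show ?case .
  qed (use a c in simp)
  show ?thesis
  proof (induction m)
    case (Suc m)
    have "a [^] k \<otimes> c [^] Suc m = (a [^] k \<otimes> c [^] m) \<otimes> c"
      using a c by (simp add: m_assoc)
    also have "\<dots> = c [^] m \<otimes> (a [^] (k * r ^ m) \<otimes> c)"
      using a c by (simp add: Suc.IH m_assoc)
    also have "\<dots> = c [^] Suc m \<otimes> a [^] (k * r ^ Suc m)"
      using a c by (simp add: 1 m_assoc ac_simps)
    finally show ?case .
  qed (use a c in simp)
qed

text \<open>Collecting the factors \<open>c\<close> on the left produces a geometric sum in the
  exponent of \<open>a\<close>. For \<open>m = p\<close> it is evaluated by
  \<open>cong_sum_powers\<close>; for commuting elements \<open>r = 1\<close> and it is just
  \<open>m\<close>.\<close>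

lemma mult_pow_swap:
  fixes k m r :: nat
  assumes a: "a \<in> carrier G" and c: "c \<in> carrier G" and ac: "a \<otimes> c = c \<otimes> a [^] r"
  shows "(c \<otimes> a [^] k) [^] m = c [^] m \<otimes> a [^] (k * (\<Sum>i<m. r ^ i))"
proof (induction m)
  case (Suc m)
  have "(c \<otimes> a [^] k) [^] Suc m =
      c [^] m \<otimes> (a [^] (k * (\<Sum>i<m. r ^ i)) \<otimes> c [^] (1::nat)) \<otimes> a [^] k"
    using a c by (simp add: Suc.IH m_assoc)
  also have "\<dots> = c [^] Suc m \<otimes> (a [^] (k * (\<Sum>i<m. r ^ i) * r) \<otimes> a [^] k)"
    unfolding pow_mult_swap[OF assms] using a c by (simp add: m_assoc)
  also have "\<dots> = c [^] Suc m \<otimes> a [^] (k * (1 + r * (\<Sum>i<m. r ^ i)))"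
    using a c by (simp add: nat_pow_mult algebra_simps)
  also have "1 + r * (\<Sum>i<m. r ^ i) = (\<Sum>i<Suc m. r ^ i)"
    by (simp only: sum.lessThan_Suc_shift sum_distrib_left power_0 power_Suc)
  finally show ?case .
qed simp

lemma metacyclic_eq_image:
  fixes M N :: nat
  assumes "a \<in> carrier G" "c \<in> carrier G" "a [^] N = \<one>" "c [^] M = \<one>" "0 < N" "0 < M"
  shows "{c [^] (j::nat) \<otimes> a [^] (k::nat) | j k. True} = (\<lambda>(j, k). c [^] j \<otimes> a [^] k) ` ({..<M} \<times> {..<N})"
proof -
  have "c [^] j \<otimes> a [^] k \<in> (\<lambda>(j, k). c [^] j \<otimes> a [^] k) ` ({..<M} \<times> {..<N})" for j k :: nat
  proof (rule image_eqI)
    show "c [^] j \<otimes> a [^] k = (\<lambda>(j, k). c [^] j \<otimes> a [^] k) (j mod M, k mod N)"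
    proof -
      have "a [^] k = a [^] (k mod N)" "c [^] j = c [^] (j mod M)"
        by (auto intro!: pow_cong assms simp: cong_def)
      then show ?thesis by (metis case_prod_conv)
    qed
  qed (use assms in simp)
  then show ?thesis by auto
qed

lemma card_metacyclic_le:
  fixes M N :: nat
  assumes "a \<in> carrier G" "c \<in> carrier G" "a [^] N = \<one>" "c [^] M = \<one>" "0 < N" "0 < M"
  shows "finite {c [^] (j::nat) \<otimes> a [^] (k::nat) | j k. True}"
    and "card {c [^] (j::nat) \<otimes> a [^] (k::nat) | j k. True} \<le> M * N"
  unfolding metacyclic_eq_image[OF assms]
  using card_image_le[of "{..<M} \<times> {..<N}" "\<lambda>(j, k). c [^] j \<otimes> a [^] k"] by auto

text \<open>The hypotheses are relations, not exact orders, so that this covers the presented group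
  as well as \<open>G\<close>.\<close>

lemma metacyclic_subgroup:
  fixes M N r :: nat
  assumes "a \<in> carrier G" "c \<in> carrier G" "a [^] N = \<one>" "c [^] M = \<one>" "0 < N" "0 < M"
    and ac: "a \<otimes> c = c \<otimes> a [^] r"
  shows "subgroup {c [^] (j::nat) \<otimes> a [^] (k::nat) | j k. True} G" (is "subgroup ?S G")
proof (rule subgroupI)
  show "?S \<subseteq> carrier G" using assms by auto
  show "?S \<noteq> {}" by auto
  have mult: "x \<otimes> y \<in> ?S" if xy: "x \<in> ?S" "y \<in> ?S" for x y
  proof -
    from xy obtain j k i l :: nat where x: "x = c [^] j \<otimes> a [^] k" and y: "y = c [^] i \<otimes> a [^] l"
      by blast
    have "x \<otimes> y = c [^] j \<otimes> (a [^] k \<otimes> c [^] i) \<otimes> a [^] l"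
      using assms(1,2) by (simp add: x y m_assoc)
    also have "\<dots> = (c [^] j \<otimes> c [^] i) \<otimes> (a [^] (k * r ^ i) \<otimes> a [^] l)"
      unfolding pow_mult_swap[OF assms(1,2) ac] using assms(1,2) by (simp add: m_assoc)
    also have "\<dots> = c [^] (j + i) \<otimes> a [^] (k * r ^ i + l)"
      using assms(1,2) by (simp add: nat_pow_mult)
    finally show ?thesis by blast
  qed
  then show "x \<otimes> y \<in> ?S" if "x \<in> ?S" "y \<in> ?S" for x y using that .
  \<comment> \<open>Both generators have finite order, so inverses are again powers with natural
    exponents.\<close>
  have inv: "inv (x [^] k) = x [^] (k * (L - 1))" if "x \<in> carrier G" "x [^] L = \<one>" "0 < L" for x and k L :: nat
  proof (rule inv_equality)
    have "x [^] (k * (L - 1)) \<otimes> x [^] k = x [^] (k * (L - 1) + k)"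
      using that by (simp add: nat_pow_mult)
    also have "k * (L - 1) + k = L * k"
      using that(3) by (cases L) (simp_all add: algebra_simps)
    also have "x [^] (L * k) = \<one>"
      using that by (simp flip: nat_pow_pow)
    finally show "x [^] (k * (L - 1)) \<otimes> x [^] k = \<one>" .
  qed (use that in auto)
  fix x assume "x \<in> ?S"
  then obtain j k :: nat where x: "x = c [^] j \<otimes> a [^] k" by blast
  have "inv x = a [^] (k * (N - 1)) \<otimes> c [^] (j * (M - 1))"
    using inv[OF assms(1,3,5)] inv[OF assms(2,4,6)] assms(1,2) by (simp add: x inv_mult_group)
  also have "\<dots> = (c [^] (0::nat) \<otimes> a [^] (k * (N - 1))) \<otimes> (c [^] (j * (M - 1)) \<otimes> a [^] (0::nat))"
    using assms(1,2) by simp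
  also have "\<dots> \<in> ?S" by (rule mult) blast+
  finally show "inv x \<in> ?S" .
qed

lemma subgroup_nat_pow_closed:
  fixes k :: nat
  assumes "subgroup H G" "x \<in> H"
  shows "x [^] k \<in> H"
  using subgroup_int_pow_closed[OF assms, of "int k"] by (simp add: int_pow_int)

section \<open>Subgroups of index p\<close>

lemma card_subgroup_prime_power:
  assumes "Factorial_Ring.prime p" "order G = p ^ n" "subgroup H G"
  obtains i where "i \<le> n" "card H = p ^ i"
  using lagrange[OF assms(3)] assms(1,2)
  by (metis divides_primepow_nat dvd_triv_right)

lemma normal_of_index_prime:
  assumes p: "Factorial_Ring.prime p" and G: "order G = p ^ Suc m"
    and A: "subgroup A G" "card A = p ^ m"
  shows "A \<lhd> G"
proof (rule normal_invI[OF A(1)])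
  have p0: "p > 0" using p by (rule prime_gt_0_nat)
  fix x c assume x: "x \<in> A" and c: "c \<in> carrier G"
  interpret A: subgroup A G by fact
  have fin: "finite (carrier G)"
    using G p0 by (metis order_gt_0_iff_finite zero_less_power)
  have idx: "card (rcosets A) = p"
    using lagrange[OF A(1)] G A(2) p0 by simp
  show "c \<otimes> x \<otimes> inv c \<in> A"
  proof (cases "c \<in> A")
    case True
    then show ?thesis using x by simp
  next
    case False
    \<comment> \<open>These \<open>p\<close> cosets avoid \<open>A\<close>, so two of them coincide and \<open>c x\<^sup>m c\<^sup>-\<^sup>1 \<in> A\<close> for some \<open>0 < m < p\<close>.\<close>
    define f where "f i = A #> (c \<otimes> x [^] i)" for i :: nat
    have "f i \<in> rcosets A - {A}" for i
    proof -
      have "c \<otimes> x [^] i \<notin> A"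
      proof
        assume "c \<otimes> x [^] i \<in> A"
        then have "c \<otimes> x [^] i \<otimes> inv (x [^] i) \<in> A"
          using x A(1) by (metis A.m_closed A.m_inv_closed subgroup_nat_pow_closed)
        then show False using False c x by (simp add: m_assoc)
      qed
      then have "f i \<noteq> A"
        unfolding f_def using c x rcos_self[OF _ A(1), of "c \<otimes> x [^] i"] by auto
      then show ?thesis
        unfolding f_def using c x by (auto intro!: rcosetsI)
    qed
    then have "f ` {..<p} \<subseteq> rcosets A - {A}" by blast
    moreover have "card (rcosets A - {A}) < p"
      using idx p0 A.subgroup_in_rcosets[OF group_axioms] by (simp add: card_Diff_singleton)
    moreover have "finite (rcosets A - {A})"
      using idx p0 by (metis card_ge_0_finite finite_Diff)
    ultimately have "\<not> inj_on f {..<p}"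
      using card_inj_on_le[of f "{..<p}" "rcosets A - {A}"] by auto
    then obtain i j where ij: "i < j" "j < p" "f i = f j"
      unfolding inj_on_def by (metis lessThan_iff nat_neq_iff)
    define m where "m = j - i"
    have xc: "x \<in> carrier G" using x by simp
    have "(c \<otimes> x [^] j) \<otimes> inv (c \<otimes> x [^] i) \<in> A"
    proof (rule A.rcos_module_imp[OF group_axioms])
      show "c \<otimes> x [^] j \<in> A #> (c \<otimes> x [^] i)"
        using ij(3) rcos_self[OF _ A(1), of "c \<otimes> x [^] j"] c xc by (simp add: f_def)
    qed (use c xc in auto)
    also have "(c \<otimes> x [^] j) \<otimes> inv (c \<otimes> x [^] i) = c \<otimes> (x [^] j \<otimes> inv (x [^] i)) \<otimes> inv c"
      using c xc by (simp add: inv_mult_group m_assoc)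
    also have "x [^] j \<otimes> inv (x [^] i) = x [^] m"
      using ij(1) xc by (simp add: inv_solve_right' nat_pow_mult m_def)
    finally have m: "c \<otimes> x [^] m \<otimes> inv c \<in> A" .
    \<comment> \<open>The order of \<open>x\<close> is a power of \<open>p\<close>, so
      \<open>m\<close> is invertible modulo it, and the conjugate of \<open>x\<close> is a power of
      the conjugate of \<open>x [^] m\<close>.\<close>
    have "\<not> p dvd m"
      using ij by (auto simp: m_def dest: dvd_imp_le)
    then have "coprime m (order G)"
      unfolding G using prime_imp_coprime[OF p] by (simp add: coprime_commute)
    then have "coprime m (ord x)"
      using ord_dvd_group_order[OF xc] by (rule coprime_divisors[OF dvd_refl, rotated])
    then obtain s where s: "[m * s = 1] (mod ord x)"
      using cong_solve_coprime_nat[of m "ord x"] by (metis One_nat_def)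
    have "(c \<otimes> x [^] m \<otimes> inv c) [^] s \<in> A"
      using m A(1) by (rule subgroup_nat_pow_closed[rotated])
    also have "(c \<otimes> x [^] m \<otimes> inv c) [^] s = c \<otimes> x [^] (m * s) \<otimes> inv c"
      using c xc by (simp add: conj_pow nat_pow_pow)
    also have "x [^] (m * s) = x"
      using s xc pow_eq_iff_cong[of x "m * s" 1] by simp
    finally show ?thesis .
  qed
qed

end

section \<open>Noncyclic p-groups with a cyclic maximal subgroup\<close>

text \<open>Noncyclicity is phrased by element orders: this form carries over to isomorphic copies
  and can be checked directly in subgroups and quotients.\<close>

locale noncyclic_p_group = group G for G (structure) +
  fixes p n :: nat
  assumes prime_p: "Factorial_Ring.prime p"
    and odd_p: "odd p"
    and order_G: "order G = p ^ n"
    and noncyclic: "x \<in> carrier G \<Longrightarrow> ord x \<noteq> p ^ n"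
begin

lemma p_gt_0: "p > 0" and p_gt_1: "p > 1"
  using prime_gt_0_nat[OF prime_p] prime_gt_1_nat[OF prime_p] by auto

lemma finite_carrier: "finite (carrier G)"
  using order_G p_gt_0 by (simp flip: order_gt_0_iff_finite)

lemma ord_prime_power:
  assumes "x \<in> carrier G"
  obtains i where "i < n" "ord x = p ^ i"
proof -
  obtain i where i: "i \<le> n" "ord x = p ^ i"
    using ord_dvd_group_order[OF assms] prime_p unfolding order_G by (auto simp: divides_primepow_nat)
  then show ?thesis
    using noncyclic[OF assms] that[of i] by (cases "i = n") auto
qed

lemma pow_eq_one: "x \<in> carrier G \<Longrightarrow> x [^] p ^ (n - 1) = \<one>"
  by (rule ord_prime_power[of x]) (auto simp: pow_eq_id le_imp_power_dvd)

lemma n_ge_2: "n \<ge> 2"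
proof (rule ccontr)
  assume "\<not> n \<ge> 2"
  moreover have "n \<noteq> 0"
    using noncyclic[of \<one>] by (cases n) auto
  ultimately have n: "n = 1" by simp
  have "x = \<one>" if "x \<in> carrier G" for x
    using pow_eq_one[OF that] that by (simp add: n)
  then have "carrier G = {\<one>}" by auto
  then show False
    using order_G p_gt_1 by (simp add: n order_def)
qed

lemma p_power_n: "p ^ n = p * p ^ (n - 1)" "p ^ (n - 1) = p * p ^ (n - 2)"
proof -
  obtain k where "n = Suc (Suc k)"
    using le_Suc_ex[OF n_ge_2] by auto
  then show "p ^ n = p * p ^ (n - 1)" "p ^ (n - 1) = p * p ^ (n - 2)" by simp_all
qed

end

locale cyclic_maximal = noncyclic_p_group +
  fixes a
  assumes a_closed [simp]: "a \<in> carrier G"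
    and ord_a: "ord a = p ^ (n - 1)"

text \<open>\<open>G\<close> as a semidirect product of <a> and <b>. Two congruences for
  \<open>r\<close> are listed to cover \<open>n = 2\<close>, where the modulus
  \<open>p ^ (n - 2)\<close> is 1.\<close>

locale split_cyclic_maximal = cyclic_maximal +
  fixes b r
  assumes b_closed [simp]: "b \<in> carrier G"
    and b_not_power: "b \<noteq> a [^] (k::nat)"
    and b_pow: "b [^] p = \<one>"
    and ab: "a \<otimes> b = b \<otimes> a [^] (r::nat)"
    and r_cong: "[r = 1] (mod p)" "[r = 1] (mod p ^ (n - 2))"

context noncyclic_p_group
begin

lemma cong_sum_powers_pred:
  assumes "[r = 1] (mod p)" "[r = 1] (mod p ^ (n - 2))"
  shows "[(\<Sum>i<p. r ^ i) = p] (mod p ^ (n - 1))"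
proof (cases "n = 2")
  case True
  then show ?thesis
    using cong_sum_powers[OF odd_p dvd_refl assms(1)] by (auto intro: cong_dvd_modulus_nat)
next
  case False
  then have n: "n - 1 = Suc (n - 2)" "p dvd p ^ (n - 2)"
    using n_ge_2 by auto
  show ?thesis
    using cong_sum_powers[OF odd_p n(2) assms(2)] unfolding n(1) power_Suc2 .
qed

end

text \<open>Any \<open>c\<close> outside <a> normalizes <a> and has its \<open>p\<close>-th power
  there. By the geometric sum, multiplying \<open>c\<close> by \<open>a [^] k\<close> multiplies
  this power by \<open>a [^] (k * p)\<close>, so it can be made trivial once it is known to be a
  \<open>p\<close>-th power in <a>.\<close>

lemma (in cyclic_maximal) split:
  obtains b r where "split_cyclic_maximal G p n a b r"
proof -
  define A where "A = generate G {a}"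
  have memA: "x \<in> A \<longleftrightarrow> (\<exists>k::nat. x = a [^] k)" for x
    unfolding A_def by (rule mem_generate_singleton[OF finite_carrier]) simp
  have A: "subgroup A G"
    unfolding A_def by (rule generate_is_subgroup) simp
  have n1: "n = Suc (n - 1)" using n_ge_2 by simp
  have cardA: "card A = p ^ (n - 1)"
    using ord_a generate_pow_card[of a] by (simp add: A_def)
  interpret N: normal A G
    using normal_of_index_prime[OF prime_p _ A cardA] order_G n1 by simp
  have "card A < card (carrier G)"
    using cardA order_G n1 p_gt_1 unfolding order_def
    by (metis lessI power_strict_increasing_iff)
  then obtain c where c: "c \<in> carrier G" "c \<notin> A"
    by (metis A subgroup.subset less_irrefl subsetI subset_antisym)
  have "inv c \<otimes> a \<otimes> c \<in> A"
    using N.inv_op_closed1[OF c(1)] memA[of a] by (metis a_closed nat_pow_eone)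
  then obtain r :: nat where "inv c \<otimes> a \<otimes> c = a [^] r" using memA by blast
  then have ac: "a \<otimes> c = c \<otimes> a [^] r"
    using c by (metis a_closed inv_closed inv_solve_left m_assoc m_closed)
  have "c [^] p \<in> A"
  proof -
    interpret Q: group "G Mod A" by (rule N.factorgroup_is_group)
    have "order (G Mod A) * p ^ (n - 1) = p * p ^ (n - 1)"
      using lagrange[OF A] n1 unfolding cardA order_G
      by (simp add: order_def FactGroup_def) (metis power_Suc)
    then have "order (G Mod A) = p" using p_gt_0 by simp
    moreover have "A #> c \<in> carrier (G Mod A)"
      using c by (auto simp: carrier_FactGroup)
    ultimately have "(A #> c) [^]\<^bsub>G Mod A\<^esub> p = A"
      using Q.pow_order_eq_1 by fastforce
    then have "A #> c [^] p = A"
      using c by (simp add: N.FactGroup_pow)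
    then show ?thesis
      using c rcos_self[OF _ A, of "c [^] p"] by simp
  qed
  then obtain m :: nat where m: "c [^] p = a [^] m" using memA by blast
  \<comment> \<open>Noncyclicity enters here, as the exponent bound \<open>pow_eq_one\<close>: for
    \<open>m\<close> prime to \<open>p\<close>, the order of \<open>c\<close> would be
    \<open>p ^ n\<close>.\<close>
  have "p dvd m"
  proof -
    have "\<one> = (c [^] p) [^] p ^ (n - 2)"
      using pow_eq_one[OF c(1)] by (simp only: nat_pow_pow[OF c(1)] p_power_n(2))
    also have "\<dots> = a [^] (m * p ^ (n - 2))" by (simp add: m nat_pow_pow)
    finally have "p ^ (n - 1) dvd m * p ^ (n - 2)"
      using ord_a pow_eq_id[of a "m * p ^ (n - 2)"] by simp
    then show ?thesis unfolding p_power_n(2) using p_gt_0 by simp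
  qed
  then obtain m' where m': "m = p * m'" ..
  \<comment> \<open>\<open>c [^] p\<close> is a power of \<open>a\<close>, so conjugating
    \<open>a\<close> by \<open>c\<close> for \<open>p\<close> times changes nothing.\<close>
  have "a [^] (r ^ p) = a [^] (1::nat)"
  proof -
    have "c [^] p \<otimes> a [^] (r ^ p) = a \<otimes> c [^] p"
      using pow_mult_swap[OF a_closed c(1) ac, of 1 p] by simp
    also have "\<dots> = c [^] p \<otimes> a"
      unfolding m using nat_pow_comm[of a 1 m] by simp
    finally show ?thesis using c by simp
  qed
  then have "[r ^ p = 1] (mod p ^ Suc (n - 2))"
    unfolding pow_eq_iff_cong[OF a_closed] ord_a p_power_n(2) power_Suc .
  note r = cong_prime_power_root[OF prime_p odd_p this]
  \<comment> \<open>\<open>k\<close> plays the role of \<open>- m'\<close> modulo the order of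
    \<open>a\<close>, so \<open>k * p\<close> cancels \<open>m\<close>.\<close>
  define k where "k = (p ^ (n - 1) - 1) * m'"
  define b where "b = c \<otimes> a [^] k"
  have b: "b \<in> carrier G" using c by (simp add: b_def)
  have "b [^] p = a [^] m \<otimes> a [^] (k * (\<Sum>i<p. r ^ i))"
    unfolding b_def mult_pow_swap[OF a_closed c(1) ac] m ..
  also have "a [^] (k * (\<Sum>i<p. r ^ i)) = a [^] (k * p)"
    using cong_sum_powers_pred[OF r] ord_a by (simp add: pow_eq_iff_cong cong_scalar_left)
  also have "a [^] m \<otimes> a [^] (k * p) = a [^] (p ^ (n - 1) * (p * m'))"
    using p_gt_0 by (simp add: nat_pow_mult m' k_def algebra_simps flip: mult_Suc)
  also have "\<dots> = \<one>"
    using ord_a by (simp add: pow_eq_id)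
  finally have bp: "b [^] p = \<one>" .
  have "split_cyclic_maximal G p n a b r"
  proof unfold_locales
    show "b \<noteq> a [^] j" for j :: nat
    proof
      assume "b = a [^] j"
      then have "c = a [^] j \<otimes> inv (a [^] k)"
        using c b by (simp add: b_def inv_solve_right)
      moreover have "\<dots> \<in> A"
      proof -
        have "a [^] i \<in> A" for i :: nat using memA by blast
        then show ?thesis using A by (simp add: subgroup.m_closed subgroup.m_inv_closed)
      qed
      ultimately show False using c by simp
    qed
    show "a \<otimes> b = b \<otimes> a [^] r"
      using c ac by (simp add: b_def m_assoc nat_pow_mult add.commute flip: m_assoc[of a c])
  qed (use b bp r in auto)
  then show ?thesis by (rule that)
qed

text \<open>\<open>h\<close> and \<open>z\<close> generate a copy of C_p x C_p; \<open>F\<close>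
  consists of its trivial subgroup and of its subgroups of order \<open>p\<close> other than <z>.
  The last conclusion serves the strict inequality: if nothing outside \<open>F\<close> avoids
  \<open>z\<close>, every element whose powers miss \<open>z\<close> must have this form.\<close>

lemma (in group) avoiding_cyclic_subgroups:
  assumes p: "Factorial_Ring.prime p" and fin: "finite (carrier G)"
    and z: "z \<in> carrier G" "ord z = p" and zh: "z \<otimes> h = h \<otimes> z"
    and h: "h \<in> carrier G" "h [^] p = \<one>" and hz: "\<And>k::nat. h \<noteq> z [^] k"
  defines "F \<equiv> insert {\<one>} ((\<lambda>i::nat. generate G {h \<otimes> z [^] i}) ` {..<p})"
  shows "card F = p + 1" "F \<subseteq> {H. subgroup H G \<and> z \<notin> H}"
    and "\<And>H y. H \<in> F \<Longrightarrow> y \<in> H \<Longrightarrow> y [^] p = \<one> \<and> (\<exists>(j::nat) (k::nat). y = h [^] j \<otimes> z [^] k)"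
proof -
  have p1: "p > 1" using p by (rule prime_gt_1_nat)
  have zp: "z [^] p = \<one>" using z by (metis pow_ord_eq_1)
  have hi: "h \<otimes> z [^] i \<in> carrier G" for i :: nat using h z by simp
  have pw: "(h \<otimes> z [^] i) [^] j = h [^] j \<otimes> z [^] (i * j)" for i j :: nat
    using mult_pow_swap[OF z(1) h(1), of 1 i j] z zh by simp
  have mem: "y \<in> generate G {h \<otimes> z [^] i} \<longleftrightarrow> (\<exists>j::nat. y = h [^] j \<otimes> z [^] (i * j))" for y and i :: nat
    using mem_generate_singleton[OF fin hi] pw by simp
  \<comment> \<open>Otherwise \<open>j\<close> is invertible modulo \<open>p\<close>, and
    \<open>h\<close> itself is a power of \<open>z\<close>.\<close>
  have hj: "p dvd j" if "h [^] j = z [^] k" for j k :: nat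
  proof (rule ccontr)
    assume "\<not> p dvd j"
    then have "coprime j p"
      using p prime_imp_coprime coprime_commute by blast
    then obtain s where "[j * s = 1] (mod p)"
      using cong_solve_coprime_nat[of j p] by (metis One_nat_def)
    then have "h [^] (j * s) = h [^] (1::nat)"
      using h by (intro pow_cong) auto
    then have "h = (z [^] k) [^] s"
      using h that by (simp flip: nat_pow_pow)
    then show False using hz z by (simp add: nat_pow_pow)
  qed
  have sub: "subgroup (generate G {h \<otimes> z [^] i}) G" for i :: nat
    using hi by (intro generate_is_subgroup) auto
  have z_notin: "z \<notin> generate G {h \<otimes> z [^] i}" for i :: nat
  proof
    assume "z \<in> generate G {h \<otimes> z [^] i}"
    then obtain j :: nat where j: "z = h [^] j \<otimes> z [^] (i * j)" using mem by blast
    then have "h [^] j = z \<otimes> inv (z [^] (i * j))"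
      using h z by (simp add: inv_solve_right)
    also have "\<dots> \<in> generate G {z}"
      using z by (meson mem_generate_singleton[OF fin z(1)] generate.incl generate_is_subgroup empty_subsetI insert_subset insertI1 subgroup.m_closed subgroup.m_inv_closed)
    finally obtain k :: nat where "h [^] j = z [^] k"
      using mem_generate_singleton[OF fin z(1)] by blast
    then obtain q where q: "j = p * q" using hj by blast
    have "h [^] j = \<one>" "z [^] (i * j) = \<one>"
      using h z zp by (simp_all add: q mult.left_commute[of i] flip: nat_pow_pow)
    then have "z = \<one>" using j by simp
    then show False using z p1 by simp
  qed
  have inj: "inj_on (\<lambda>i::nat. generate G {h \<otimes> z [^] i}) {..<p}"
  proof (rule linorder_inj_onI')
    fix i j :: nat assume ij: "i \<in> {..<p}" "j \<in> {..<p}" "i < j"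
    show "generate G {h \<otimes> z [^] i} \<noteq> generate G {h \<otimes> z [^] j}"
    proof
      assume eq: "generate G {h \<otimes> z [^] i} = generate G {h \<otimes> z [^] j}"
      define K where "K = generate G {h \<otimes> z [^] i}"
      have K: "subgroup K G" using sub by (simp add: K_def)
      have "h \<otimes> z [^] i \<in> K" "h \<otimes> z [^] j \<in> K"
        unfolding K_def by (auto intro: generate.incl) (auto simp: eq intro: generate.incl)
      \<comment> \<open>Two generators in the same subgroup differ by \<open>z [^] (j - i)\<close>,
        of which \<open>z\<close> is a power because \<open>0 < j - i < p\<close>.\<close>
      then have "inv (h \<otimes> z [^] i) \<otimes> (h \<otimes> z [^] j) \<in> K"
        using K by (meson subgroup.m_closed subgroup.m_inv_closed)
      also have "h \<otimes> z [^] j = (h \<otimes> z [^] i) \<otimes> z [^] (j - i)"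
        using h z ij(3) by (simp add: m_assoc nat_pow_mult)
      also have "inv (h \<otimes> z [^] i) \<otimes> \<dots> = z [^] (j - i)"
        using h z by (simp flip: m_assoc[of "inv (h \<otimes> z [^] i)"])
      finally have zK: "z [^] (j - i) \<in> K" .
      have "\<not> p dvd j - i" using ij by (auto dest: dvd_imp_le)
      then have "coprime (j - i) p"
        using p prime_imp_coprime coprime_commute by blast
      then obtain s where "[(j - i) * s = 1] (mod p)"
        using cong_solve_coprime_nat[of "j - i" p] by (metis One_nat_def)
      then have "z [^] ((j - i) * s) = z [^] (1::nat)"
        using z zp by (intro pow_cong) auto
      then have "z = (z [^] (j - i)) [^] s"
        using z by (simp add: nat_pow_pow)
      also have "\<dots> \<in> K" using K zK by (rule subgroup_nat_pow_closed)
      finally show False using z_notin by (simp add: K_def)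
    qed
  qed
  have "{\<one>} \<noteq> generate G {h \<otimes> z [^] i}" for i :: nat
  proof
    assume "{\<one>} = generate G {h \<otimes> z [^] i}"
    then have "h \<otimes> z [^] i = \<one>"
      by (metis generate.incl insertI1 singletonD)
    then have "h = z [^] ((p - 1) * i)"
    proof -
      have "z [^] ((p - 1) * i) \<otimes> z [^] i = z [^] (p * i)"
        using z p1 by (simp add: nat_pow_mult algebra_simps)
      also have "\<dots> = \<one>" using z zp by (simp flip: nat_pow_pow)
      finally show ?thesis
        using \<open>h \<otimes> z [^] i = \<one>\<close> h z by (metis nat_pow_closed r_cancel)
    qed
    then show False using hz by blast
  qed
  then have "{\<one>} \<notin> (\<lambda>i::nat. generate G {h \<otimes> z [^] i}) ` {..<p}" by auto
  then show "card F = p + 1"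
    unfolding F_def using inj by (simp add: card_image)
  have "z \<noteq> \<one>" using z p1 by auto
  then show "F \<subseteq> {H. subgroup H G \<and> z \<notin> H}"
    unfolding F_def using sub z_notin triv_subgroup by auto
  show "y [^] p = \<one> \<and> (\<exists>(j::nat) (k::nat). y = h [^] j \<otimes> z [^] k)" if H: "H \<in> F" "y \<in> H" for H y
  proof (cases "H = {\<one>}")
    case True
    then have "y = h [^] (0::nat) \<otimes> z [^] (0::nat)" using H by simp
    then show ?thesis using H True by (metis nat_pow_one singletonD)
  next
    case False
    then obtain i :: nat where "y \<in> generate G {h \<otimes> z [^] i}"
      using H unfolding F_def by blast
    then obtain j :: nat where j: "y = h [^] j \<otimes> z [^] (i * j)" using mem by blast
    then have "y = (h \<otimes> z [^] i) [^] j" by (simp add: pw)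
    then have "y [^] p = ((h \<otimes> z [^] i) [^] p) [^] j"
      using hi by (simp add: nat_pow_pow mult.commute)
    also have "(h \<otimes> z [^] i) [^] p = \<one>"
      using h z zp by (simp add: pw mult.commute[of i] flip: nat_pow_pow)
    finally show ?thesis using j by auto
  qed
qed

section \<open>The split case: normal form, p-th powers, and the subgroups that avoid
  \<open>z\<close>\<close>

context split_cyclic_maximal
begin

lemma a_pow_b_pow: "a \<otimes> b [^] j = b [^] j \<otimes> a [^] (r ^ j)" for j :: nat
  using pow_mult_swap[OF a_closed b_closed ab, of 1 j] by simp

text \<open>The products form a subgroup that properly contains <a>, and <a> has index
  \<open>p\<close>.\<close>

lemma exhaust:
  assumes "g \<in> carrier G"
  obtains j k :: nat where "g = b [^] j \<otimes> a [^] k"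
proof -
  let ?S = "{b [^] (j::nat) \<otimes> a [^] (k::nat) | j k. True}"
  have S: "subgroup ?S G"
    by (rule metacyclic_subgroup[of a b "p ^ n" p r])
      (use p_gt_0 b_pow ab pow_order_eq_1[of a] order_G in auto)
  obtain i where i: "i \<le> n" "card ?S = p ^ i"
    by (rule card_subgroup_prime_power[OF prime_p order_G S])
  have "generate G {a} \<subset> ?S"
  proof (rule psubsetI)
    have "a [^] k \<in> ?S" for k :: nat
      by (rule CollectI, rule exI[of _ 0], rule exI[of _ k]) simp
    then show "generate G {a} \<subseteq> ?S"
      unfolding subset_iff mem_generate_singleton[OF finite_carrier a_closed] by blast
    have "b \<in> ?S"
      by (rule CollectI, rule exI[of _ 1], rule exI[of _ 0]) simp
    moreover have "b \<notin> generate G {a}"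
      using b_not_power mem_generate_singleton[OF finite_carrier a_closed] by blast
    ultimately show "generate G {a} \<noteq> ?S" by blast
  qed
  moreover have "finite ?S"
    using S finite_carrier by (meson finite_subset subgroup.subset)
  ultimately have "p ^ (n - 1) < p ^ i"
    using psubset_card_mono[of ?S "generate G {a}"] unfolding i(2) generate_pow_card[OF a_closed, symmetric] ord_a
    by blast
  then have "n - 1 < i"
    using p_gt_1 by (simp add: power_strict_increasing_iff)
  then have "i = n" using i(1) by simp
  then have "?S = carrier G"
    using i S order_G finite_carrier by (metis card_subset_eq order_def subgroup.subset)
  then show ?thesis using assms that by blast
qed

text \<open>\<open>r ^ j\<close> satisfies the same congruences as \<open>r\<close>, so the
  geometric sum is again \<open>p\<close> modulo the order of \<open>a\<close>.\<close>

lemma pow_p: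
  fixes j k :: nat
  shows "(b [^] j \<otimes> a [^] k) [^] p = a [^] (k * p)"
proof -
  have "(b [^] j \<otimes> a [^] k) [^] p = (b [^] j) [^] p \<otimes> a [^] (k * (\<Sum>i<p. (r ^ j) ^ i))"
    by (rule mult_pow_swap) (use a_pow_b_pow in auto)
  also have "(b [^] j) [^] p = \<one>"
    using b_pow by (simp add: nat_pow_pow mult.commute[of j] flip: nat_pow_pow[of b p])
  also have "a [^] (k * (\<Sum>i<p. (r ^ j) ^ i)) = a [^] (k * p)"
    using cong_sum_powers_pred[of "r ^ j"] r_cong cong_pow[of r 1 _ j] ord_a
    by (simp add: pow_eq_iff_cong cong_scalar_left)
  finally show ?thesis by simp
qed

definition z where "z = a [^] p ^ (n - 2)"

lemma z_closed [simp]: "z \<in> carrier G"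
  by (simp add: z_def)

lemma ord_z: "ord z = p"
proof -
  have "ord z = p ^ (n - 1) div p ^ (n - 2)"
    unfolding z_def using p_gt_0 by (subst ord_pow) (auto simp: ord_a le_imp_power_dvd)
  then show ?thesis unfolding p_power_n(2) using p_gt_0 by simp
qed

text \<open>Multiplying \<open>r = 1\<close> modulo \<open>p\<close> by \<open>p ^ (n - 2)\<close>
  gives a congruence modulo the order of \<open>a\<close>, so \<open>b\<close> commutes with
  \<open>z\<close>.\<close>

lemma z_central:
  assumes "g \<in> carrier G"
  shows "z \<otimes> g = g \<otimes> z"
proof -
  have zb: "z \<otimes> b [^] j = b [^] j \<otimes> z" for j :: nat
  proof -
    have "[p ^ (n - 2) * r ^ j = p ^ (n - 2) * 1] (mod p ^ (n - 2) * p)"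
      using cong_pow[OF r_cong(1), of j] by (simp add: cong_def mod_mult_mult1)
    then have "a [^] (p ^ (n - 2) * r ^ j) = z"
      unfolding z_def using ord_a p_power_n(2) by (simp add: pow_eq_iff_cong mult.commute)
    then show ?thesis
      using pow_mult_swap[OF a_closed b_closed ab, of "p ^ (n - 2)" j] by (simp add: z_def)
  qed
  obtain j k :: nat where g: "g = b [^] j \<otimes> a [^] k" by (rule exhaust[OF assms])
  have za: "z \<otimes> a [^] k = a [^] k \<otimes> z"
    unfolding z_def by (simp add: nat_pow_mult add.commute)
  have "z \<otimes> g = (z \<otimes> b [^] j) \<otimes> a [^] k"
    unfolding g by (simp add: m_assoc)
  also have "\<dots> = b [^] j \<otimes> (z \<otimes> a [^] k)"
    unfolding zb by (simp add: m_assoc)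
  also have "\<dots> = g \<otimes> z"
    unfolding g za by (simp add: m_assoc)
  finally show ?thesis .
qed

text \<open>The cyclic \<open>p\<close>-group <a> has only one minimal subgroup, namely <z>.\<close>

lemma z_mem_if_pow_mem:
  fixes k :: nat
  assumes H: "subgroup H G" and "a [^] k \<in> H" "a [^] k \<noteq> \<one>"
  shows "z \<in> H"
proof -
  have "\<not> p ^ (n - 1) dvd k"
    using assms(3) by (simp add: pow_eq_id ord_a)
  then obtain s where "[k * s = p ^ (n - 1 - 1)] (mod p ^ (n - 1))"
    using prime_power_multiple_unit[OF prime_p, of "n - 1" k] n_ge_2 by auto
  then have "a [^] (k * s) = z"
    by (simp add: z_def pow_eq_iff_cong ord_a numeral_2_eq_2)
  then show ?thesis
    using subgroup_nat_pow_closed[OF H assms(2), of s] by (simp add: nat_pow_pow)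
qed

lemma b_not_power_z: "b \<noteq> z [^] k" for k :: nat
  using b_not_power by (simp add: z_def nat_pow_pow)

text \<open>A subgroup without \<open>z\<close> meets <a> trivially. Its \<open>p\<close>-th powers
  lie in <a> by \<open>pow_p\<close>, so they are trivial, which confines the subgroup to <b, z>.
  There the family of \<open>avoiding_cyclic_subgroups\<close> with \<open>h = b\<close> is
  complete.\<close>

lemma card_avoiding_z: "card {H. subgroup H G \<and> z \<notin> H} = p + 1"
proof -
  define F where "F = insert {\<one>} ((\<lambda>i::nat. generate G {b \<otimes> z [^] i}) ` {..<p})"
  note F = avoiding_cyclic_subgroups[OF prime_p finite_carrier z_closed ord_z
      z_central[OF b_closed] b_closed b_pow b_not_power_z, folded F_def]
  have "H \<in> F" if H: "subgroup H G" "z \<notin> H" for H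
  proof (cases "H = {\<one>}")
    case False
    interpret H: subgroup H G by fact
    have aH: "a [^] k = \<one>" if "a [^] k \<in> H" for k :: nat
      using z_mem_if_pow_mem[OF H(1) that] H(2) by blast
    have form: "\<exists>(j::nat) (k::nat). h = b [^] j \<otimes> z [^] k" if h: "h \<in> H" for h
    proof -
      obtain j k :: nat where jk: "h = b [^] j \<otimes> a [^] k"
        using exhaust[of h] h H.subset by blast
      have "a [^] (k * p) \<in> H"
        using pow_p[of j k] subgroup_nat_pow_closed[OF H(1) h, of p] by (simp add: jk)
      then have "p ^ (n - 1) dvd k * p"
        using aH by (simp add: pow_eq_id ord_a)
      then obtain q where "k = p ^ (n - 2) * q"
        unfolding p_power_n(2) using p_gt_0 by (auto simp: mult.commute[of p])
      then have "h = b [^] j \<otimes> z [^] q" using jk by (simp add: z_def nat_pow_pow)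
      then show ?thesis by blast
    qed
    obtain h where h: "h \<in> H" "h \<noteq> \<one>" using False H.one_closed by blast
    obtain j k :: nat where jk: "h = b [^] j \<otimes> z [^] k" using form h by blast
    have zp: "z [^] p = \<one>" using ord_z by (metis pow_ord_eq_1 z_closed)
    have "\<not> p dvd j"
    proof
      assume "p dvd j"
      then have "b [^] j = \<one>" using b_pow by (auto simp flip: nat_pow_pow)
      then have "h = a [^] (p ^ (n - 2) * k)" using jk by (simp add: z_def nat_pow_pow)
      then show False using aH h by blast
    qed
    then have "coprime j p"
      using prime_p prime_imp_coprime coprime_commute by blast
    then obtain s where s: "[j * s = 1] (mod p)"
      using cong_solve_coprime_nat[of j p] by (metis One_nat_def)
    \<comment> \<open>Raising \<open>h\<close> to the power \<open>s\<close> brings the exponent of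
      \<open>b\<close> to 1; the reduction modulo \<open>p\<close> puts the index into the range
      used by \<open>F\<close>.\<close>
    define i where "i = k * s mod p"
    have "h [^] s = b [^] (j * s) \<otimes> z [^] (k * s)"
      unfolding jk using pow_mult_distrib[of "b [^] j" "z [^] k" s] z_central[of "b [^] j"]
        pow_mult_swap[OF z_closed b_closed, of 1 k j] z_central[OF b_closed]
      by (simp add: nat_pow_pow)
    also have "b [^] (j * s) = b"
      using pow_cong[OF b_closed b_pow s] by simp
    also have "z [^] (k * s) = z [^] i"
      by (rule pow_cong[OF z_closed zp]) (simp add: i_def cong_def)
    finally have bz: "b \<otimes> z [^] i \<in> H"
      using subgroup_nat_pow_closed[OF H(1) h(1), of s] by simp
    have "H = generate G {b \<otimes> z [^] i}"
    proof
      show "generate G {b \<otimes> z [^] i} \<subseteq> H"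
        using bz H(1) by (intro generate_subgroup_incl) auto
      show "H \<subseteq> generate G {b \<otimes> z [^] i}"
      proof
        fix y assume y: "y \<in> H"
        then obtain j k :: nat where jk: "y = b [^] j \<otimes> z [^] k" using form by blast
        \<comment> \<open>\<open>w\<close> has the same power of \<open>b\<close> as
          \<open>y\<close>, so their quotient lies both in \<open>H\<close> and in <a> and is
          trivial.\<close>
        define w where "w = (b \<otimes> z [^] i) [^] j"
        have w: "w \<in> H" unfolding w_def by (rule subgroup_nat_pow_closed[OF H(1) bz])
        have "w = b [^] j \<otimes> z [^] (i * j)"
          unfolding w_def using mult_pow_swap[OF z_closed b_closed, of 1 i j] z_central[OF b_closed] by simp
        then have "inv w \<otimes> y = inv (z [^] (i * j)) \<otimes> (inv (b [^] j) \<otimes> (b [^] j \<otimes> z [^] k))"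
          unfolding jk by (simp add: inv_mult_group m_assoc)
        also have "\<dots> = inv (z [^] (i * j)) \<otimes> z [^] k"
          by (simp flip: m_assoc[of "inv (b [^] j)"])
        also have "\<dots> \<in> generate G {a}"
          unfolding z_def nat_pow_pow[OF a_closed]
          by (intro subgroup.m_closed subgroup.m_inv_closed generate_is_subgroup)
            (auto simp: mem_generate_singleton[OF finite_carrier])
        finally obtain l :: nat where l: "inv w \<otimes> y = a [^] l"
          using mem_generate_singleton[OF finite_carrier a_closed] by blast
        moreover have "inv w \<otimes> y \<in> H" using w y by simp
        ultimately have "inv w \<otimes> y = \<one>" using aH by simp
        then have "y = w"
          using w y H.subset by (metis H.mem_carrier inv_closed inv_equality inv_inv)
        then show "y \<in> generate G {b \<otimes> z [^] i}"
          unfolding w_def using mem_generate_singleton[OF finite_carrier] by auto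
      qed
    qed
    moreover have "i < p" using p_gt_0 by (simp add: i_def)
    ultimately show ?thesis unfolding F_def by blast
  qed (simp add: F_def)
  then have "{H. subgroup H G \<and> z \<notin> H} = F" using F(2) by blast
  then show ?thesis using F(1) by simp
qed

end

section \<open>Central elements, quotients and isomorphism invariance\<close>

text \<open>The class equation: orbits of the conjugation action have \<open>p\<close>-power size,
  so if the identity were the only fixed point, \<open>p ^ n\<close> would be 1 modulo
  \<open>p\<close>. A power of a nontrivial central element then has order \<open>p\<close>.\<close>

lemma (in group) prime_power_group_central_element:
  assumes p: "Factorial_Ring.prime p" and G: "order G = p ^ n" and n: "n > 0"
  obtains z where "z \<in> carrier G" "ord z = p" "\<And>g. g \<in> carrier G \<Longrightarrow> z \<otimes> g = g \<otimes> z"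
proof -
  have p1: "p > 1" using p by (rule prime_gt_1_nat)
  have fin: "finite (carrier G)"
    using G p1 by (simp flip: order_gt_0_iff_finite)
  define \<phi> where "\<phi> = (\<lambda>g. \<lambda>h \<in> carrier G. g \<otimes> h \<otimes> inv g)"
  interpret C: group_action G "carrier G" \<phi>
    unfolding \<phi>_def by (rule action_by_conjugation)
  have orb: "orbit G \<phi> x = {g \<otimes> x \<otimes> inv g | g. g \<in> carrier G}" if "x \<in> carrier G" for x
    using that by (simp add: orbit_def \<phi>_def)
  have central: "x \<otimes> g = g \<otimes> x" if "x \<in> carrier G" "g \<in> carrier G" "orbit G \<phi> x = {x}" for x g
  proof -
    have "g \<otimes> x \<otimes> inv g = x" using that orb[of x] by blast
    then show ?thesis using that by (metis inv_closed inv_solve_right m_closed)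
  qed
  have "\<exists>x \<in> carrier G. x \<noteq> \<one> \<and> orbit G \<phi> x = {x}"
  proof (rule ccontr)
    assume *: "\<not> ?thesis"
    have one: "orbit G \<phi> \<one> = {\<one>}"
      unfolding orb[OF one_closed] by (auto intro!: exI[of _ \<one>])
    have dvd: "p dvd card U" if "U \<in> orbits G (carrier G) \<phi> - {{\<one>}}" for U
    proof -
      from that obtain x where x: "x \<in> carrier G" "U = orbit G \<phi> x" "U \<noteq> {\<one>}"
        unfolding orbits_def by blast
      then have "x \<noteq> \<one>" using one by blast
      obtain i where i: "card U = p ^ i"
        using C.orbit_stabilizer_theorem[OF x(1)] x(2) G p
        by (metis divides_primepow_nat dvd_triv_left)
      have "i \<noteq> 0"
      proof
        assume "i = 0"
        then obtain y where "U = {y}" using i by (auto simp: card_1_singleton_iff)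
        moreover have "x \<in> U" using C.orbit_refl x by simp
        ultimately show False using * x \<open>x \<noteq> \<one>\<close> by blast
      qed
      then show ?thesis using i by simp
    qed
    have fin_orbits: "finite (orbits G (carrier G) \<phi>)"
      using fin C.orbits_coverture by (metis finite_UnionD)
    have one_orbit: "{\<one>} \<in> orbits G (carrier G) \<phi>"
      using one unfolding orbits_def by (metis (mono_tags, lifting) mem_Collect_eq one_closed)
    have "p ^ n = (\<Sum>U\<in>orbits G (carrier G) \<phi>. card U)"
      using C.disjoint_sum[OF fin, of "\<lambda>_. 1::nat"] G by (simp add: order_def)
    also have "\<dots> = 1 + (\<Sum>U\<in>orbits G (carrier G) \<phi> - {{\<one>}}. card U)"
      using sum.remove[OF fin_orbits one_orbit, of card] by simp
    finally have "p ^ n = 1 + (\<Sum>U\<in>orbits G (carrier G) \<phi> - {{\<one>}}. card U)" .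
    moreover have "p dvd (\<Sum>U\<in>orbits G (carrier G) \<phi> - {{\<one>}}. card U)"
      by (rule dvd_sum) (rule dvd)
    moreover have "p dvd p ^ n" using n by simp
    ultimately have "p dvd 1" by (metis dvd_add_left_iff)
    then show False using p1 by simp
  qed
  then obtain x where x: "x \<in> carrier G" "x \<noteq> \<one>" "orbit G \<phi> x = {x}" by blast
  obtain i where i: "ord x = p ^ i"
    using ord_dvd_group_order[OF x(1)] G p by (metis divides_primepow_nat)
  have "i \<noteq> 0" using i x ord_eq_1[of x] by (cases i) auto
  then obtain j where j: "i = Suc j" by (cases i) auto
  show ?thesis
  proof (rule that[of "x [^] p ^ j"])
    show "ord (x [^] p ^ j) = p"
      using ord_pow[OF x(1), of "p ^ j"] p1 i j by simp
    show "x [^] p ^ j \<otimes> g = g \<otimes> x [^] p ^ j" if g: "g \<in> carrier G" for g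
      using pow_mult_swap[OF x(1) g, of 1 "p ^ j" 1] central[OF x(1) g x(3)] x g by simp
  qed (use x in simp)
qed

lemma (in group) central_cyclic_normal:
  assumes "finite (carrier G)" "z \<in> carrier G" "\<And>g. g \<in> carrier G \<Longrightarrow> z \<otimes> g = g \<otimes> z"
  shows "generate G {z} \<lhd> G"
proof (rule normal_invI)
  show "subgroup (generate G {z}) G" using assms by (intro generate_is_subgroup) auto
  fix x g assume x: "x \<in> generate G {z}" and g: "g \<in> carrier G"
  obtain k :: nat where k: "x = z [^] k" using x mem_generate_singleton[OF assms(1,2)] by blast
  have "z [^] k \<otimes> g = g \<otimes> z [^] k"
    using pow_mult_swap[OF assms(2) g, of 1 k 1] assms g by simp
  then have "g \<otimes> x \<otimes> inv g = x"
    using k assms g by (metis inv_solve_right m_closed nat_pow_closed)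
  then show "g \<otimes> x \<otimes> inv g \<in> generate G {z}" using x by simp
qed

section \<open>Independent elements of order p\<close>

lemma (in noncyclic_p_group) second_prime_order_element:
  assumes "z \<in> carrier G" "z [^] p = \<one>" "x \<in> carrier G" "x [^] p = \<one>" "x \<noteq> \<one>"
    "y \<in> carrier G" "y [^] p = \<one>" "\<And>k::nat. y \<noteq> x [^] k"
  shows "\<exists>h \<in> carrier G. h [^] p = \<one> \<and> (\<forall>k::nat. h \<noteq> z [^] k)"
proof (cases "\<exists>k::nat. x = z [^] k")
  case True
  then obtain k :: nat where k: "x = z [^] k" by blast
  \<comment> \<open>The nontrivial \<open>x\<close> has \<open>z\<close> among its powers, so the
    powers of \<open>z\<close> do not include \<open>y\<close>.\<close>
  have "\<not> p dvd k"
    using assms(1,2,5) k by (auto simp flip: nat_pow_pow)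
  then have "coprime k p"
    using prime_p prime_imp_coprime coprime_commute by blast
  then obtain s where "[k * s = 1] (mod p)"
    using cong_solve_coprime_nat[of k p] by (metis One_nat_def)
  then have "z = x [^] s"
    using pow_cong[OF assms(1,2)] assms(1) k by (metis nat_pow_eone nat_pow_pow)
  then have "y \<noteq> z [^] k" for k :: nat
    using assms(3,8) by (simp add: nat_pow_pow)
  then show ?thesis using assms by blast
qed (use assms in blast)

text \<open>A subgroup \<open>A\<close> of index \<open>p\<close> is either noncyclic and contains
  such a pair by induction, or it is cyclic and the splitting provides \<open>z\<close> and
  \<open>b\<close>. The group is a variable of the statement because the induction passes from
  \<open>G\<close> to \<open>A\<close>.\<close>

lemma noncyclic_p_group_prime_order_elements:
  assumes "noncyclic_p_group G p n"
  shows "\<exists>x \<in> carrier G. \<exists>y \<in> carrier G. x [^]\<^bsub>G\<^esub> p = \<one>\<^bsub>G\<^esub> \<and> x \<noteq> \<one>\<^bsub>G\<^esub> \<and>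
    y [^]\<^bsub>G\<^esub> p = \<one>\<^bsub>G\<^esub> \<and> (\<forall>k::nat. y \<noteq> x [^]\<^bsub>G\<^esub> k)"
  using assms
proof (induction n arbitrary: G)
  case 0
  then show ?case using noncyclic_p_group.n_ge_2 by fastforce
next
  case (Suc m)
  interpret noncyclic_p_group G p "Suc m" by (rule Suc.prems)
  obtain A where A: "subgroup A G" "card A = p ^ m"
    using sylow_thm[OF _ group_axioms, of p m p] prime_p order_G finite_carrier
    by (auto simp: prime_elem_nat_iff mult.commute)
  interpret A: group "G\<lparr>carrier := A\<rparr>" by (rule subgroup_imp_group[OF A(1)])
  have pow: "x [^]\<^bsub>G\<lparr>carrier := A\<rparr>\<^esub> k = x [^]\<^bsub>G\<^esub> k" for x and k :: nat
    by (simp flip: nat_pow_consistent)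
  have ordA: "A.ord x = ord x" for x
    unfolding A.ord_def ord_def pow by simp
  show ?case
  proof (cases "\<exists>a\<in>A. ord a = p ^ m")
    case True
    then obtain a where a: "a \<in> carrier G" "ord a = p ^ m"
      using subgroup.subset[OF A(1)] by blast
    interpret cyclic_maximal G p "Suc m" a
      by unfold_locales (use a in auto)
    obtain b r where "split_cyclic_maximal G p (Suc m) a b r" by (rule split)
    then interpret split_cyclic_maximal G p "Suc m" a b r .
    have "z [^]\<^bsub>G\<^esub> p = \<one>\<^bsub>G\<^esub>" using ord_z by (metis pow_ord_eq_1 z_closed)
    moreover have "z \<noteq> \<one>\<^bsub>G\<^esub>" using ord_z p_gt_1 by auto
    ultimately show ?thesis
      using b_pow b_not_power_z by (intro bexI[of _ z] bexI[of _ b]) auto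
  next
    case False
    have "noncyclic_p_group (G\<lparr>carrier := A\<rparr>) p m"
    proof unfold_locales
      show "order (G\<lparr>carrier := A\<rparr>) = p ^ m" using A(2) by (simp add: order_def)
      show "A.ord x \<noteq> p ^ m" if "x \<in> carrier (G\<lparr>carrier := A\<rparr>)" for x
        using False that by (auto simp: ordA)
    qed (use prime_p odd_p in auto)
    from Suc.IH[OF this] show ?thesis
      using subgroup.subset[OF A(1)] by (simp add: pow) blast
  qed
qed

text \<open>The correspondence theorem. A subgroup of the quotient is a set of cosets, and its union
  is the corresponding subgroup of \<open>G\<close>.\<close>

lemma (in normal) card_subgroups_of_quotient:
  "card (subgroups_of (G Mod H)) = card {K. subgroup K G \<and> H \<subseteq> K}"
proof (rule bij_betw_same_card[of Union])
  interpret Q: group "G Mod H" by (rule factorgroup_is_group)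
  interpret h: group_hom G "G Mod H" "\<lambda>x. H #> x"
    by (unfold_locales) (rule r_coset_hom_Mod)
  have recover: "A = (\<lambda>x. H #> x) ` \<Union>A" if A: "subgroup A (G Mod H)" for A
    using subgroup.subset[OF A] unfolding factgroup_subgroup_union_char[OF A] carrier_FactGroup by auto
  show "bij_betw Union (subgroups_of (G Mod H)) {K. subgroup K G \<and> H \<subseteq> K}"
  proof (rule bij_betw_imageI)
    show "inj_on Union (subgroups_of (G Mod H))"
      unfolding subgroups_of_def by (rule inj_onI) (metis mem_Collect_eq recover)
    show "Union ` subgroups_of (G Mod H) = {K. subgroup K G \<and> H \<subseteq> K}"
    proof (intro equalityI subsetI)
      fix K assume "K \<in> Union ` subgroups_of (G Mod H)"
      then obtain A where A: "subgroup A (G Mod H)" "K = \<Union>A" by (auto simp: subgroups_of_def)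
      have "H \<in> A" using subgroup.one_closed[OF A(1)] by simp
      then show "K \<in> {K. subgroup K G \<and> H \<subseteq> K}"
        using A factgroup_subgroup_union_subgroup by auto
    next
      fix K assume "K \<in> {K. subgroup K G \<and> H \<subseteq> K}"
      then have K: "subgroup K G" "H \<subseteq> K" by auto
      define A where "A = (\<lambda>x. H #> x) ` K"
      have A: "subgroup A (G Mod H)"
        unfolding A_def by (rule h.subgroup_img_is_subgroup[OF K(1)])
      have "\<Union>A = K"
      proof
        show "\<Union>A \<subseteq> K"
          using K by (auto simp: A_def r_coset_def intro: subgroup.m_closed)
        show "K \<subseteq> \<Union>A"
          using rcos_self[OF _ subgroup_axioms] subgroup.subset[OF K(1)] by (auto simp: A_def)
      qed
      then show "K \<in> Union ` subgroups_of (G Mod H)"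
        using A by (auto simp: subgroups_of_def)
    qed
  qed
qed

text \<open>The recursion that drives the induction: a subgroup contains <z> as soon as it contains
  \<open>z\<close>.\<close>

lemma (in group) card_subgroups_of_split:
  assumes "finite (carrier G)" "z \<in> carrier G" and "generate G {z} \<lhd> G"
  shows "card (subgroups_of G) =
    card (subgroups_of (G Mod generate G {z})) + card {H. subgroup H G \<and> z \<notin> H}"
proof -
  have eq: "generate G {z} \<subseteq> K \<longleftrightarrow> z \<in> K" if "subgroup K G" for K
    using generate_subgroup_incl[OF _ that, of "{z}"] generate.incl[of z "{z}" G] by blast
  have "subgroups_of G = {K. subgroup K G \<and> generate G {z} \<subseteq> K} \<union> {H. subgroup H G \<and> z \<notin> H}"
    using eq by (auto simp: subgroups_of_def)
  moreover have "finite {H. subgroup H G}"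
    by (rule finite_subset[of _ "Pow (carrier G)"]) (use assms(1) subgroup.subset in auto)
  then have "finite {K. subgroup K G \<and> generate G {z} \<subseteq> K}" "finite {H. subgroup H G \<and> z \<notin> H}"
    by (auto elim: finite_subset[rotated])
  moreover have "{K. subgroup K G \<and> generate G {z} \<subseteq> K} \<inter> {H. subgroup H G \<and> z \<notin> H} = {}"
    using eq by auto
  ultimately show ?thesis
    using normal.card_subgroups_of_quotient[OF assms(3)] by (simp add: card_Un_disjoint)
qed

section \<open>Invariance under isomorphism\<close>

lemma card_subgroups_of_iso_le:
  assumes "group G" "group H" "finite (carrier H)" and f: "f \<in> iso G H"
  shows "card (subgroups_of G) \<le> card (subgroups_of H)"
proof (rule card_inj_on_le)
  interpret group_hom G H f
    using assms by (simp add: group_hom_def group_hom_axioms_def iso_iff)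
  have inj: "inj_on f (carrier G)" using f by (simp add: iso_def bij_betw_def)
  show "inj_on ((`) f) (subgroups_of G)"
    by (rule inj_on_subset[OF inj_on_image_Pow[OF inj]])
      (auto simp: subgroups_of_def dest: subgroup.subset)
  show "(`) f ` subgroups_of G \<subseteq> subgroups_of H"
    by (auto simp: subgroups_of_def intro: subgroup_img_is_subgroup)
  show "finite (subgroups_of H)"
    by (rule finite_subset[of _ "Pow (carrier H)"])
      (use assms(3) in \<open>auto simp: subgroups_of_def dest: subgroup.subset\<close>)
qed

lemma card_subgroups_of_iso:
  assumes "group G" "group H" "finite (carrier G)" and "G \<cong> H"
  shows "card (subgroups_of G) = card (subgroups_of H)"
proof (rule antisym)
  obtain f where f: "f \<in> iso G H" using assms(4) by (auto simp: is_iso_def)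
  show "card (subgroups_of G) \<le> card (subgroups_of H)"
    using f assms iso_finite card_subgroups_of_iso_le by blast
  show "card (subgroups_of H) \<le> card (subgroups_of G)"
    using group.iso_set_sym[OF assms(1) f] assms card_subgroups_of_iso_le by blast
qed

lemma ord_iso:
  assumes "group G" "group H" and f: "f \<in> iso G H" and x: "x \<in> carrier G"
  shows "group.ord H (f x) = group.ord G x"
proof -
  interpret group_hom G H f
    using assms by (simp add: group_hom_def group_hom_axioms_def iso_iff)
  have inj: "inj_on f (carrier G)" using f by (simp add: iso_def bij_betw_def)
  have "f x [^]\<^bsub>H\<^esub> k = \<one>\<^bsub>H\<^esub> \<longleftrightarrow> x [^]\<^bsub>G\<^esub> k = \<one>\<^bsub>G\<^esub>" for k :: nat
    using inj_onD[OF inj, of "x [^]\<^bsub>G\<^esub> k" "\<one>\<^bsub>G\<^esub>"] x by (auto simp flip: hom_nat_pow)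
  then show ?thesis
    using x by (subst H.ord_unique) (auto simp: G.pow_eq_id)
qed

lemma exists_ord_iso:
  assumes "group G" "group H" "G \<cong> H"
  shows "(\<exists>x\<in>carrier G. group.ord G x = m) \<longleftrightarrow> (\<exists>x\<in>carrier H. group.ord H x = m)"
proof -
  obtain f where f: "f \<in> iso G H" using assms(3) by (auto simp: is_iso_def)
  have "carrier H = f ` carrier G" using f by (auto simp: iso_iff)
  then show ?thesis using ord_iso[OF assms(1,2) f] by auto
qed

lemma noncyclic_p_group_iso:
  assumes G: "noncyclic_p_group G p n" and H: "group H" and iso: "G \<cong> H"
  shows "noncyclic_p_group H p n"
proof -
  interpret noncyclic_p_group G p n by fact
  interpret H: group H by fact
  show ?thesis
  proof unfold_locales
    show "order H = p ^ n" using iso_same_card[OF iso] order_G by (simp add: order_def)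
    show "H.ord x \<noteq> p ^ n" if "x \<in> carrier H" for x
      using exists_ord_iso[OF group_axioms H iso, of "p ^ n"] noncyclic that by blast
  qed (use prime_p odd_p in auto)
qed

text \<open>The quotient is a group on sets of elements, whereas the induction hypothesis speaks of
  groups on the original type only. A choice of coset representatives moves the quotient back to
  that type.\<close>

lemma (in normal) quotient_copy:
  obtains Q :: "'a monoid" where "group Q" "G Mod H \<cong> Q"
proof -
  interpret Q: group "G Mod H" by (rule factorgroup_is_group)
  define f where "f C = (SOME x. x \<in> C)" for C :: "'a set"
  have f: "f C \<in> C" if "C \<in> carrier (G Mod H)" for C
  proof -
    have "C \<noteq> {}" using that rcosets_non_empty by (simp add: FactGroup_def)
    then show ?thesis unfolding f_def by (simp add: some_in_eq)
  qed
  have "inj_on f (carrier (G Mod H))"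
  proof (rule inj_onI)
    fix C D assume "C \<in> carrier (G Mod H)" "D \<in> carrier (G Mod H)" "f C = f D"
    then show "C = D"
      using f[of C] f[of D] rcos_disjoint[OF subgroup_axioms]
      by (fastforce simp: FactGroup_def pairwise_def disjnt_def)
  qed
  then show ?thesis
    using that[of "image_group f (G Mod H)"] Q.inj_imp_image_group_is_group inj_imp_image_group_iso
    by (auto intro: is_isoI)
qed

text \<open>Starts the induction: for \<open>n = 2\<close> the quotient by <z> has order
  \<open>p\<close>, so it is cyclic and the induction hypothesis does not apply to it.\<close>

lemma (in group) card_subgroups_of_prime_order:
  assumes "Factorial_Ring.prime p" "order G = p"
  shows "card (subgroups_of G) = 2"
proof -
  have p1: "p > 1" using assms(1) by (rule prime_gt_1_nat)
  have fin: "finite (carrier G)" using assms p1 by (simp flip: order_gt_0_iff_finite)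
  have "H = {\<one>} \<or> H = carrier G" if H: "subgroup H G" for H
  proof -
    interpret H: subgroup H G by fact
    have "card H dvd p" using lagrange[OF H] assms(2) by (metis dvd_triv_right)
    then consider "card H = 1" | "card H = p" using assms(1) by (metis prime_nat_iff)
    then show ?thesis
    proof cases
      case 1
      then show ?thesis using H.one_closed by (metis card_1_singletonE singletonD)
    next
      case 2
      then show ?thesis using assms(2) fin H.subset by (metis card_subset_eq order_def)
    qed
  qed
  then have "subgroups_of G = {{\<one>}, carrier G}"
    using triv_subgroup subgroup_self by (auto simp: subgroups_of_def)
  moreover have "{\<one>} \<noteq> carrier G"
  proof
    assume "{\<one>} = carrier G"
    then have "order G = card {\<one>}" by (simp only: order_def)
    then show False using assms(2) p1 by simp
  qed
  ultimately show ?thesis by simp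
qed

section \<open>The number of subgroups\<close>

lemma (in normal) FactGroup_pow_eq_one_iff:
  fixes k :: nat
  assumes "x \<in> carrier G"
  shows "(H #> x) [^]\<^bsub>G Mod H\<^esub> k = \<one>\<^bsub>G Mod H\<^esub> \<longleftrightarrow> x [^] k \<in> H"
proof -
  have "H #> x [^] k = H \<longleftrightarrow> x [^] k \<in> H"
    using coset_join1[OF _ _ subgroup_axioms] coset_join2[OF _ subgroup_axioms] assms by blast
  then show ?thesis using assms by (simp add: FactGroup_pow)
qed

lemma (in noncyclic_p_group) order_quotient:
  assumes "z \<in> carrier G" "ord z = p"
  shows "order (G Mod generate G {z}) = p ^ (n - 1)"
proof -
  have "order (G Mod generate G {z}) = card (rcosets generate G {z})"
    by (simp add: order_def FactGroup_def)
  moreover have "card (rcosets generate G {z}) * p = p * p ^ (n - 1)"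
    using lagrange[OF generate_is_subgroup, of "{z}"] assms generate_pow_card[of z]
    unfolding order_G p_power_n(1) by simp
  ultimately have "order (G Mod generate G {z}) * p = p ^ (n - 1) * p"
    by (metis mult.commute)
  then show ?thesis using p_gt_0 by simp
qed

context split_cyclic_maximal
begin

lemma z_normal: "generate G {z} \<lhd> G"
  by (rule central_cyclic_normal[OF finite_carrier z_closed z_central])

text \<open>The quotient has the same shape with \<open>n - 1\<close> in place of \<open>n\<close>,
  so the induction hypothesis is sharp for it. It is noncyclic since \<open>pow_p\<close> makes
  every \<open>p ^ (n - 2)\<close>-th power in \<open>G\<close> a power of \<open>z\<close>. The
  image of \<open>a\<close> keeps order \<open>p ^ (n - 2)\<close>, because <z> is the part of <a>
  that is lost.\<close>

lemma
  assumes "n \<ge> 3"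
  shows quotient_noncyclic: "noncyclic_p_group (G Mod generate G {z}) p (n - 1)"
    and quotient_ord_a: "\<exists>C\<in>carrier (G Mod generate G {z}). group.ord (G Mod generate G {z}) C = p ^ (n - 2)"
proof -
  define Z where "Z = generate G {z}"
  interpret Z: normal Z G unfolding Z_def by (rule z_normal)
  interpret Q: group "G Mod Z" by (rule Z.factorgroup_is_group)
  have memZ: "x \<in> Z \<longleftrightarrow> (\<exists>k::nat. x = z [^] k)" for x
    unfolding Z_def by (rule mem_generate_singleton[OF finite_carrier z_closed])
  have n: "n - 2 = Suc (n - 3)" "n - 1 = Suc (n - 2)" using assms by auto
  have "Q.ord C \<noteq> p ^ (n - 1)" if C: "C \<in> carrier (G Mod Z)" for C
  proof
    assume *: "Q.ord C = p ^ (n - 1)"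
    obtain g where g: "g \<in> carrier G" "C = Z #> g" using C by (auto simp: carrier_FactGroup)
    obtain j k :: nat where jk: "g = b [^] j \<otimes> a [^] k" by (rule exhaust[OF g(1)])
    have "g [^] p ^ (n - 2) = (g [^] p) [^] p ^ (n - 3)"
      using g by (simp add: n(1) nat_pow_pow)
    also have "\<dots> = (a [^] (k * p)) [^] p ^ (n - 3)"
      unfolding jk pow_p ..
    also have "\<dots> = z [^] k"
      by (simp add: z_def nat_pow_pow n(1) ac_simps)
    finally have "C [^]\<^bsub>G Mod Z\<^esub> p ^ (n - 2) = \<one>\<^bsub>G Mod Z\<^esub>"
      unfolding g(2) Z.FactGroup_pow_eq_one_iff[OF g(1)] using memZ by blast
    then have "p ^ (n - 1) dvd p ^ (n - 2)"
      using * C Q.pow_eq_id by metis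
    then show False
      using p_gt_1 n(2) by (simp add: power_dvd_imp_le)
  qed
  then show "noncyclic_p_group (G Mod Z) p (n - 1)"
    using order_quotient[OF z_closed ord_z, folded Z_def] prime_p odd_p
    by unfold_locales auto
  have aC: "Z #> a \<in> carrier (G Mod Z)" by (auto simp: carrier_FactGroup)
  have "Q.ord (Z #> a) = p ^ (n - 2)"
  proof (rule Q.pow_prime_power_ord[OF prime_p aC])
    have "z \<in> Z" using memZ[of z] by (metis nat_pow_eone z_closed)
    then show "(Z #> a) [^]\<^bsub>G Mod Z\<^esub> p ^ (n - 2) = \<one>\<^bsub>G Mod Z\<^esub>"
      unfolding Z.FactGroup_pow_eq_one_iff[OF a_closed] z_def .
    show "0 < n - 2" using assms by simp
    show "(Z #> a) [^]\<^bsub>G Mod Z\<^esub> p ^ (n - 2 - 1) \<noteq> \<one>\<^bsub>G Mod Z\<^esub>"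
    proof
      assume "(Z #> a) [^]\<^bsub>G Mod Z\<^esub> p ^ (n - 2 - 1) = \<one>\<^bsub>G Mod Z\<^esub>"
      then have "a [^] p ^ (n - 3) \<in> Z"
        unfolding Z.FactGroup_pow_eq_one_iff[OF a_closed] by (simp add: n(1))
      then obtain k :: nat where "a [^] p ^ (n - 3) = z [^] k" using memZ by blast
      then have "(a [^] p ^ (n - 3)) [^] p = (z [^] p) [^] k"
        by (simp add: nat_pow_pow mult.commute)
      also have "z [^] p = \<one>" using ord_z by (metis pow_ord_eq_1 z_closed)
      finally have "z = \<one>" by (simp add: z_def nat_pow_pow n(1) mult.commute)
      then show False using ord_z p_gt_1 by simp
    qed
  qed
  then show "\<exists>C\<in>carrier (G Mod Z). Q.ord C = p ^ (n - 2)" using aC by blast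
qed

end

text \<open>All three conclusions rest on the exponent: with no element of order
  \<open>p ^ (n - 1)\<close> it divides \<open>p ^ (n - 2)\<close>. This bound passes to the
  quotient, and it prevents a lift of an element of order \<open>p ^ (n - 2)\<close> from having
  \<open>z\<close> among its powers.\<close>

lemma (in noncyclic_p_group)
  assumes no_max: "\<And>x. x \<in> carrier G \<Longrightarrow> ord x \<noteq> p ^ (n - 1)"
    and z: "z \<in> carrier G" "ord z = p" "\<And>g. g \<in> carrier G \<Longrightarrow> z \<otimes> g = g \<otimes> z"
  shows quotient_noncyclic_if_no_cyclic_maximal: "noncyclic_p_group (G Mod generate G {z}) p (n - 1)"
    and card_avoiding_ge: "card {H. subgroup H G \<and> z \<notin> H} \<ge> p + 1"
    and card_avoiding_gt: "\<exists>C\<in>carrier (G Mod generate G {z}). group.ord (G Mod generate G {z}) C = p ^ (n - 2) \<Longrightarrow>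
      card {H. subgroup H G \<and> z \<notin> H} \<noteq> p + 1"
proof -
  define Z where "Z = generate G {z}"
  interpret Z: normal Z G
    unfolding Z_def by (rule central_cyclic_normal[OF finite_carrier z(1,3)])
  interpret Q: group "G Mod Z" by (rule Z.factorgroup_is_group)
  have memZ: "x \<in> Z \<longleftrightarrow> (\<exists>k::nat. x = z [^] k)" for x
    unfolding Z_def by (rule mem_generate_singleton[OF finite_carrier z(1)])
  have zp: "z [^] p = \<one>" using z by (metis pow_ord_eq_1)
  have oneZ: "\<one> \<in> Z" by (rule Z.one_closed)
  have pow1: "x [^] p ^ (n - 2) = \<one>" if x: "x \<in> carrier G" for x
    using pow_prime_power_ord[OF prime_p x pow_eq_one[OF x]] no_max[OF x] n_ge_2
    by (auto simp: numeral_2_eq_2)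
  \<comment> \<open>For \<open>n = 2\<close> the element \<open>z\<close> would have the excluded
    order \<open>p ^ (n - 1)\<close>.\<close>
  have "n \<noteq> 2"
    using no_max[OF z(1)] z(2) by auto
  then have n: "n - 2 = Suc (n - 3)" "n - 1 = Suc (n - 2)" "n \<ge> 3" using n_ge_2 by auto
  have "Q.ord C \<noteq> p ^ (n - 1)" if C: "C \<in> carrier (G Mod Z)" for C
  proof
    assume *: "Q.ord C = p ^ (n - 1)"
    obtain g where g: "g \<in> carrier G" "C = Z #> g" using C by (auto simp: carrier_FactGroup)
    have "C [^]\<^bsub>G Mod Z\<^esub> p ^ (n - 2) = \<one>\<^bsub>G Mod Z\<^esub>"
      unfolding g(2) Z.FactGroup_pow_eq_one_iff[OF g(1)] using pow1[OF g(1)] oneZ by simp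
    then have "p ^ (n - 1) dvd p ^ (n - 2)"
      using * C Q.pow_eq_id by metis
    then show False
      using p_gt_1 n(2) by (simp add: power_dvd_imp_le)
  qed
  then show "noncyclic_p_group (G Mod Z) p (n - 1)"
    using order_quotient[OF z(1,2), folded Z_def] prime_p odd_p
    by unfold_locales auto
  obtain x y where "x \<in> carrier G" "x [^] p = \<one>" "x \<noteq> \<one>" "y \<in> carrier G" "y [^] p = \<one>"
    "\<And>k::nat. y \<noteq> x [^] k"
    using noncyclic_p_group_prime_order_elements[OF noncyclic_p_group_axioms] by blast
  then obtain h where h: "h \<in> carrier G" "h [^] p = \<one>" "\<And>k::nat. h \<noteq> z [^] k"
    using second_prime_order_element[OF z(1) zp, of x y] by blast
  define F where "F = insert {\<one>} ((\<lambda>i::nat. generate G {h \<otimes> z [^] i}) ` {..<p})"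
  note F = avoiding_cyclic_subgroups[OF prime_p finite_carrier z(1,2) z(3)[OF h(1)] h, folded F_def]
  have fin: "finite {H. subgroup H G \<and> z \<notin> H}"
    by (rule finite_subset[of _ "Pow (carrier G)"]) (use finite_carrier subgroup.subset in auto)
  show "card {H. subgroup H G \<and> z \<notin> H} \<ge> p + 1"
    using card_mono[OF fin F(2)] F(1) by simp
  assume "\<exists>C\<in>carrier (G Mod Z). Q.ord C = p ^ (n - 2)"
  then obtain x where x: "x \<in> carrier G" "Q.ord (Z #> x) = p ^ (n - 2)"
    by (auto simp: carrier_FactGroup)
  show "card {H. subgroup H G \<and> z \<notin> H} \<noteq> p + 1"
  proof
    assume "card {H. subgroup H G \<and> z \<notin> H} = p + 1"
    then have F_eq: "F = {H. subgroup H G \<and> z \<notin> H}"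
      using card_subset_eq[OF fin F(2)] F(1) by simp
    \<comment> \<open>If only the members of \<open>F\<close> avoid \<open>z\<close>, this applies
      to the cyclic subgroup of any \<open>g\<close> that does not have \<open>z\<close> among its
      powers.\<close>
    have cyc: "g [^] p = \<one> \<and> (\<exists>(j::nat) (k::nat). g = h [^] j \<otimes> z [^] k)"
      if g: "g \<in> carrier G" "z \<notin> generate G {g}" for g
    proof (rule F(3))
      show "generate G {g} \<in> F"
        unfolding F_eq using g by (auto intro: generate_is_subgroup)
      show "g \<in> generate G {g}" by (rule generate.incl) simp
    qed
    \<comment> \<open>If \<open>z\<close> were \<open>x [^] k\<close>, this power would vanish in
      the quotient, so \<open>p ^ (n - 2)\<close> would divide \<open>k\<close>; but
      \<open>x [^] p ^ (n - 2)\<close> is already trivial.\<close>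
    have "z \<notin> generate G {x}"
    proof
      assume "z \<in> generate G {x}"
      then obtain k :: nat where k: "z = x [^] k"
        using mem_generate_singleton[OF finite_carrier x(1)] by blast
      then have "x [^] k \<in> Z" using memZ[of z] z(1) by (metis nat_pow_eone)
      then have "(Z #> x) [^]\<^bsub>G Mod Z\<^esub> k = \<one>\<^bsub>G Mod Z\<^esub>"
        using Z.FactGroup_pow_eq_one_iff[OF x(1)] by blast
      moreover have "Z #> x \<in> carrier (G Mod Z)" using x by (auto simp: carrier_FactGroup)
      ultimately have "p ^ (n - 2) dvd k" using x(2) Q.pow_eq_id by metis
      then have "z = \<one>" using k pow1[OF x(1)] x(1) by (auto simp flip: nat_pow_pow)
      then show False using z p_gt_1 by simp
    qed
    then have xp: "x [^] p = \<one>" using cyc x by blast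
    show False
    proof (cases "n = 3")
      case False
      have "(Z #> x) [^]\<^bsub>G Mod Z\<^esub> p = \<one>\<^bsub>G Mod Z\<^esub>"
        unfolding Z.FactGroup_pow_eq_one_iff[OF x(1)] using xp oneZ by simp
      moreover have "Z #> x \<in> carrier (G Mod Z)" using x by (auto simp: carrier_FactGroup)
      ultimately have "p ^ (n - 2) dvd p ^ 1" using x(2) Q.pow_eq_id by (metis power_one_right)
      then have "n - 2 \<le> 1" using p_gt_1 by (metis power_dvd_imp_le)
      then show False using False n(3) by simp
    next
      case True
      \<comment> \<open>Now every element has trivial \<open>p\<close>-th power, so one with
        \<open>z\<close> among its powers is itself a power of \<open>z\<close>. All other elements
        fall under \<open>cyc\<close>; hence \<open>E\<close> would exhaust a group of order
        \<open>p ^ 3\<close>.\<close>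
      define E where "E = {h [^] (j::nat) \<otimes> z [^] (k::nat) | j k. True}"
      have E: "finite E" "card E \<le> p * p"
        using card_metacyclic_le[OF z(1) h(1) zp h(2) p_gt_0 p_gt_0] by (simp_all add: E_def)
      have "carrier G \<subseteq> E"
      proof
        fix g assume g: "g \<in> carrier G"
        show "g \<in> E"
        proof (cases "z \<in> generate G {g}")
          case False
          then show ?thesis using cyc[OF g] by (auto simp: E_def)
        next
          case zg: True
          then obtain k :: nat where k: "z = g [^] k"
            using mem_generate_singleton[OF finite_carrier g] by blast
          have gp: "g [^] p = \<one>" using pow1[OF g] True by simp
          have "\<not> p dvd k"
          proof
            assume "p dvd k"
            then have "z = \<one>" using gp g k by (auto simp flip: nat_pow_pow)
            then show False using z(2) p_gt_1 by simp
          qed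
          then have "coprime k p"
            using prime_p prime_imp_coprime coprime_commute by blast
          then obtain s where "[k * s = 1] (mod p)"
            using cong_solve_coprime_nat[of k p] by (metis One_nat_def)
          then have "g [^] (k * s) = g [^] (1::nat)"
            by (rule pow_cong[OF g gp])
          then have "g = z [^] s" using g k by (simp add: nat_pow_pow)
          then have "g = h [^] (0::nat) \<otimes> z [^] s" using z by simp
          then show ?thesis unfolding E_def by blast
        qed
      qed
      then have "card (carrier G) \<le> p * p"
        using card_mono[OF E(1)] E(2) by (meson le_trans)
      then have "p ^ 3 \<le> p * p"
        using order_G True by (simp add: order_def)
      then show False using p_gt_1 by (simp add: power3_eq_cube)
    qed
  qed
qed

text \<open>Equality is characterized by an element order rather than by isomorphism types, since
  this is the form that the step from the quotient to \<open>G\<close> can use. \<open>G\<close> is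
  a plain \<open>monoid\<close>, like the groups that \<open>quotient_copy\<close> supplies.\<close>

lemma noncyclic_p_group_card_subgroups:
  fixes G :: "'a monoid"
  assumes "noncyclic_p_group G p n"
  shows "(p + 1) * (n - 1) + 2 \<le> card (subgroups_of G) \<and>
    (card (subgroups_of G) = (p + 1) * (n - 1) + 2 \<longleftrightarrow> (\<exists>a\<in>carrier G. group.ord G a = p ^ (n - 1)))"
  using assms
proof (induction n arbitrary: G)
  case 0
  then show ?case using noncyclic_p_group.n_ge_2[OF 0] by simp
next
  case (Suc m)
  interpret noncyclic_p_group G p "Suc m" by (rule Suc.prems)
  have IH: "(p + 1) * (m - 1) + 2 \<le> card (subgroups_of (G Mod N)) \<and>
      (card (subgroups_of (G Mod N)) = (p + 1) * (m - 1) + 2 \<longleftrightarrow>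
        (\<exists>C\<in>carrier (G Mod N). group.ord (G Mod N) C = p ^ (m - 1)))"
    if N: "N \<lhd> G" and Q: "noncyclic_p_group (G Mod N) p m" for N
  proof -
    obtain Q' :: "'a monoid" where Q': "group Q'" "G Mod N \<cong> Q'"
      by (rule normal.quotient_copy[OF N])
    have grp: "group (G Mod N)" by (rule normal.factorgroup_is_group[OF N])
    show ?thesis
      using Suc.IH[OF noncyclic_p_group_iso[OF Q Q']]
        card_subgroups_of_iso[OF grp Q'(1) noncyclic_p_group.finite_carrier[OF Q] Q'(2)]
        exists_ord_iso[OF grp Q', of "p ^ (m - 1)"]
      by simp
  qed
  have m: "m \<ge> 1" using n_ge_2 by simp
  have count: "(p + 1) * (Suc m - 1) + 2 = (p + 1) * (m - 1) + 2 + (p + 1)"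
    using m by (cases m) (simp_all add: algebra_simps)
  show ?case
  proof (cases "\<exists>a\<in>carrier G. ord a = p ^ m")
    case True
    then obtain a where a: "a \<in> carrier G" "ord a = p ^ m" by blast
    interpret cyclic_maximal G p "Suc m" a
      by unfold_locales (use a in auto)
    obtain b r where "split_cyclic_maximal G p (Suc m) a b r" by (rule split)
    then interpret split_cyclic_maximal G p "Suc m" a b r .
    have "card (subgroups_of (G Mod generate G {z})) = (p + 1) * (m - 1) + 2"
    proof (cases "m = 1")
      case True
      then show ?thesis
        using group.card_subgroups_of_prime_order[OF normal.factorgroup_is_group[OF z_normal] prime_p]
          order_quotient[OF z_closed ord_z] by simp
    next
      case False
      then have "Suc m \<ge> 3" using m by simp
      then show ?thesis
        using IH[OF z_normal] quotient_noncyclic quotient_ord_a by (simp add: numeral_2_eq_2)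
    qed
    then have "card (subgroups_of G) = (p + 1) * (Suc m - 1) + 2"
      unfolding count card_subgroups_of_split[OF finite_carrier z_closed z_normal] card_avoiding_z by simp
    then show ?thesis using a by auto
  next
    case False
    then have no: "ord x \<noteq> p ^ (Suc m - 1)" if "x \<in> carrier G" for x using that by auto
    obtain z where z: "z \<in> carrier G" "ord z = p" "\<And>g. g \<in> carrier G \<Longrightarrow> z \<otimes>\<^bsub>G\<^esub> g = g \<otimes>\<^bsub>G\<^esub> z"
      using prime_power_group_central_element[OF prime_p order_G] by blast
    have N: "generate G {z} \<lhd> G"
      by (rule central_cyclic_normal[OF finite_carrier z(1,3)])
    have Q: "noncyclic_p_group (G Mod generate G {z}) p m"
      using quotient_noncyclic_if_no_cyclic_maximal[OF no z] by simp
    note IH = IH[OF N Q]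
    note avoid = card_avoiding_ge[OF no z] card_avoiding_gt[OF no z]
    \<comment> \<open>Either the quotient attains its bound, and then more than \<open>p + 1\<close>
      subgroups avoid \<open>z\<close>, or the excess comes from the quotient.\<close>
    have "(p + 1) * (Suc m - 1) + 2 < card (subgroups_of G)"
    proof (cases "card (subgroups_of (G Mod generate G {z})) = (p + 1) * (m - 1) + 2")
      case True
      then have "card {H. subgroup H G \<and> z \<notin> H} \<noteq> p + 1"
        using IH avoid(2) by (simp add: numeral_2_eq_2)
      then show ?thesis
        unfolding count card_subgroups_of_split[OF finite_carrier z(1) N] using True avoid(1) by simp
    next
      case False
      then show ?thesis
        unfolding count card_subgroups_of_split[OF finite_carrier z(1) N] using IH avoid(1) by simp
    qed
    then show ?thesis using False by auto
  qed
qed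

section \<open>The groups with a cyclic maximal subgroup\<close>

text \<open>Translates the assumption of the theorem on the isomorphism type of \<open>G\<close>
  into the condition on element orders in \<open>noncyclic_p_group\<close>.\<close>

lemma (in group) iso_integer_mod_group:
  assumes fin: "finite (carrier G)" and x: "x \<in> carrier G" "ord x = order G"
  shows "G \<cong> integer_mod_group (order G)"
proof -
  define N where "N = order G"
  have N: "N > 0" using fin by (simp add: N_def order_gt_0_iff_finite)
  have xN: "x [^] N = \<one>" using x by (metis N_def pow_ord_eq_1)
  define f where "f i = x [^] nat i" for i :: int
  have carr: "carrier (integer_mod_group N) = {0..<int N}"
    using N by (simp add: carrier_integer_mod_group)
  have "f \<in> hom (integer_mod_group N) G"
  proof (rule homI)
    fix i j assume "i \<in> carrier (integer_mod_group N)" "j \<in> carrier (integer_mod_group N)"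
    then have "nat ((i + j) mod int N) = (nat i + nat j) mod N"
      by (simp add: carr nat_mod_distrib nat_add_distrib)
    then have "f ((i + j) mod int N) = x [^] (nat i + nat j)"
      unfolding f_def using pow_cong[OF x(1) xN, of "(nat i + nat j) mod N"] by (simp add: cong_def)
    then show "f (i \<otimes>\<^bsub>integer_mod_group N\<^esub> j) = f i \<otimes> f j"
      using x by (simp add: f_def nat_pow_mult)
  qed (simp add: f_def x)
  moreover have inj: "inj_on f (carrier (integer_mod_group N))"
  proof (rule inj_onI)
    fix i j assume ij: "i \<in> carrier (integer_mod_group N)" "j \<in> carrier (integer_mod_group N)" "f i = f j"
    then have "[nat i = nat j] (mod N)"
      using pow_eq_iff_cong[OF x(1)] x(2) by (simp add: f_def N_def)
    moreover have "nat i < N" "nat j < N" using ij N by (auto simp: carr)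
    ultimately have "nat i = nat j" by (simp add: cong_def)
    then show "i = j" using ij by (simp add: carr eq_nat_nat_iff)
  qed
  moreover have "f ` carrier (integer_mod_group N) = carrier G"
  proof (rule card_subset_eq[OF fin])
    show "f ` carrier (integer_mod_group N) \<subseteq> carrier G" using x by (auto simp: f_def)
    show "card (f ` carrier (integer_mod_group N)) = card (carrier G)"
      unfolding card_image[OF inj] unfolding carr by (simp add: N_def order_def)
  qed
  ultimately have "integer_mod_group N \<cong> G"
    by (intro is_isoI) (simp add: iso_def bij_betw_def)
  then show ?thesis
    using group.iso_sym[OF group_integer_mod_group] by (simp add: N_def)
qed

text \<open>An upper bound on the order of the source replaces a proof of injectivity; for the
  presented group nothing more is known in advance.\<close>

lemma is_iso_if_surj_card_le:
  assumes h: "h \<in> hom G H" "h ` carrier G = carrier H"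
    and "finite (carrier G)" "card (carrier G) \<le> card (carrier H)"
  shows "G \<cong> H"
proof -
  have "card (h ` carrier G) = card (carrier G)"
    using assms card_image_le[OF assms(3), of h] by simp
  then have "inj_on h (carrier G)"
    by (rule eq_card_imp_inj_on[OF assms(3)])
  then show ?thesis
    using h by (intro is_isoI) (simp add: iso_def bij_betw_def)
qed

lemma (in split_cyclic_maximal) iso_direct_product_if_commute:
  assumes comm: "a \<otimes> b = b \<otimes> a"
  shows "G \<cong> integer_mod_group (p ^ (n - 1)) \<times>\<times> integer_mod_group p"
proof -
  define N where "N = p ^ (n - 1)"
  let ?D = "integer_mod_group N \<times>\<times> integer_mod_group p"
  have N: "N > 0" using p_gt_0 by (simp add: N_def)
  have aN: "a [^] N = \<one>" using ord_a by (metis N_def a_closed pow_ord_eq_1)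
  have swap: "a [^] k \<otimes> b [^] j = b [^] j \<otimes> a [^] k" for j k :: nat
    using pow_mult_swap[OF a_closed b_closed, of 1 k j] comm by simp
  have carr: "carrier ?D = {0..<int N} \<times> {0..<int p}"
    using N p_gt_0 by (simp add: carrier_integer_mod_group)
  define f where "f = (\<lambda>(i, j). a [^] nat i \<otimes> b [^] nat j)"
  have red: "x [^] nat ((i + j) mod int M) = x [^] nat i \<otimes> x [^] nat j"
    if "x \<in> carrier G" "x [^] M = \<one>" "0 \<le> i" "0 \<le> j" for x and M :: nat and i j :: int
  proof -
    have "nat ((i + j) mod int M) = (nat i + nat j) mod M"
      using that by (simp add: nat_mod_distrib nat_add_distrib)
    then have "x [^] nat ((i + j) mod int M) = x [^] (nat i + nat j)"
      using pow_cong[OF that(1,2), of "(nat i + nat j) mod M" "nat i + nat j"] by (simp add: cong_def)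
    then show ?thesis unfolding nat_pow_mult[OF that(1)] .
  qed
  have "f \<in> hom ?D G"
  proof (rule homI)
    fix u v assume "u \<in> carrier ?D" "v \<in> carrier ?D"
    then obtain i j i' j' where uv: "u = (i, j)" "v = (i', j')" "0 \<le> i" "0 \<le> j" "0 \<le> i'" "0 \<le> j'"
      unfolding carr by auto
    have "f (u \<otimes>\<^bsub>?D\<^esub> v) = (a [^] nat i \<otimes> a [^] nat i') \<otimes> (b [^] nat j \<otimes> b [^] nat j')"
      using uv by (simp add: f_def red[OF a_closed aN] red[OF b_closed b_pow])
    also have "\<dots> = a [^] nat i \<otimes> (a [^] nat i' \<otimes> b [^] nat j) \<otimes> b [^] nat j'"
      by (simp add: m_assoc)
    also have "\<dots> = f u \<otimes> f v"
      unfolding swap using uv by (simp add: f_def m_assoc)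
    finally show "f (u \<otimes>\<^bsub>?D\<^esub> v) = f u \<otimes> f v" .
  qed (auto simp: f_def)
  moreover have "f ` carrier ?D = carrier G"
  proof
    show "f ` carrier ?D \<subseteq> carrier G" by (auto simp: f_def)
    show "carrier G \<subseteq> f ` carrier ?D"
    proof
      fix g assume "g \<in> carrier G"
      then obtain j k :: nat where g: "g = b [^] j \<otimes> a [^] k" by (rule exhaust)
      have "a [^] k = a [^] (k mod N)" "b [^] j = b [^] (j mod p)"
        using aN b_pow by (auto intro!: pow_cong simp: cong_def)
      then have "g = a [^] (k mod N) \<otimes> b [^] (j mod p)"
        unfolding g using swap by metis
      then have "g = f (int (k mod N), int (j mod p))"
        unfolding f_def prod.case nat_int .
      moreover have "(int (k mod N), int (j mod p)) \<in> carrier ?D"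
        unfolding carr using N p_gt_0 by simp
      ultimately show "g \<in> f ` carrier ?D" by blast
    qed
  qed
  moreover have "card (carrier ?D) = p ^ n"
    unfolding carr p_power_n(1) N_def[symmetric] by (simp add: card_cartesian_product)
  then have "card (carrier ?D) \<le> card (carrier G)"
    using order_G by (simp add: order_def)
  moreover have "finite (carrier ?D)" unfolding carr by simp
  ultimately have "?D \<cong> G" by (intro is_iso_if_surj_card_le)
  then have "G \<cong> ?D"
    by (rule group.iso_sym[rotated]) (simp add: DirProd_group)
  then show ?thesis by (simp only: N_def)
qed

text \<open>Write \<open>r = 1 + p ^ (n - 2) * t\<close>. Noncommutativity means that
  \<open>p\<close> does not divide \<open>t\<close>. Passing from \<open>b\<close> to
  \<open>b [^] s\<close> replaces \<open>t\<close> by \<open>t * s\<close> up to the order of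
  \<open>a\<close>, so \<open>s\<close> is chosen as an inverse of \<open>t\<close> modulo
  \<open>p\<close>.\<close>

lemma (in split_cyclic_maximal) modular_complement:
  assumes "a \<otimes> b \<noteq> b \<otimes> a"
  obtains c where "split_cyclic_maximal G p n a c (1 + p ^ (n - 2))"
proof -
  have "r \<noteq> 0"
  proof
    assume "r = 0"
    then have "p dvd 1" using r_cong(1) by (simp add: cong_def mod_eq_0_iff_dvd)
    then show False using p_gt_1 by simp
  qed
  then have dvd: "[r = 1] (mod d) \<longleftrightarrow> d dvd r - 1" for d
    by (simp add: cong_altdef_nat)
  obtain t where t: "r - 1 = p ^ (n - 2) * t"
    using r_cong(2) unfolding dvd by blast
  have r: "r = 1 + p ^ (n - 2) * t" using t \<open>r \<noteq> 0\<close> by simp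
  have "\<not> p dvd t"
  proof
    assume "p dvd t"
    then have "p ^ (n - 1) dvd r - 1"
      unfolding t p_power_n(2) by (metis mult.commute mult_dvd_mono dvd_refl)
    then have "a [^] r = a [^] (1::nat)"
      unfolding pow_eq_iff_cong[OF a_closed] ord_a dvd .
    then show False using assms ab by simp
  qed
  \<comment> \<open>For \<open>n = 2\<close> the order of \<open>a\<close> is \<open>p\<close>, and
    \<open>r = 1\<close> modulo \<open>p\<close> already makes \<open>a\<close> and \<open>b\<close>
    commute.\<close>
  moreover have "n \<noteq> 2"
  proof
    assume "n = 2"
    then have "p dvd t" using r_cong(1) unfolding dvd t by simp
    then show False using \<open>\<not> p dvd t\<close> by blast
  qed
  then have n: "n \<ge> 3" using n_ge_2 by simp
  ultimately have "coprime t p"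
    using prime_p prime_imp_coprime coprime_commute by blast
  then obtain s where s: "[t * s = 1] (mod p)"
    using cong_solve_coprime_nat[of t p] by (metis One_nat_def)
  \<comment> \<open>The quadratic terms of \<open>r ^ s\<close> vanish since
    \<open>2 * (n - 2) \<ge> n - 1\<close> for \<open>n \<ge> 3\<close>.\<close>
  have "p ^ (n - 1) dvd (p ^ (n - 2) * t)\<^sup>2"
  proof -
    have "p ^ (n - 1) dvd p ^ ((n - 2) * 2)"
      by (rule le_imp_power_dvd) (use n in simp)
    then show ?thesis by (simp add: power_mult_distrib flip: power_mult)
  qed
  then have "[r ^ s = 1 + s * (p ^ (n - 2) * t)] (mod p ^ (n - 1))"
    unfolding r by (rule cong_one_plus_pow)
  moreover have "[s * (p ^ (n - 2) * t) = p ^ (n - 2)] (mod p ^ (n - 1))"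
  proof -
    have "[p ^ (n - 2) * (t * s) = p ^ (n - 2) * 1] (mod p ^ (n - 2) * p)"
      using s by (simp add: cong_def mod_mult_mult1)
    then show ?thesis unfolding p_power_n(2) by (simp add: ac_simps)
  qed
  ultimately have rs: "[r ^ s = 1 + p ^ (n - 2)] (mod p ^ (n - 1))"
    by (meson cong_add_lcancel_nat cong_trans)
  have "split_cyclic_maximal G p n a (b [^] s) (1 + p ^ (n - 2))"
  proof unfold_locales
    show "b [^] s \<noteq> a [^] k" for k :: nat
    proof
      assume *: "b [^] s = a [^] k"
      have "b [^] (t * s) = b [^] (1::nat)" by (rule pow_cong[OF b_closed b_pow s])
      then have "b = (b [^] s) [^] t" by (simp add: nat_pow_pow mult.commute)
      also have "\<dots> = a [^] (k * t)" unfolding * by (simp add: nat_pow_pow)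
      finally show False using b_not_power by blast
    qed
    show "(b [^] s) [^] p = \<one>"
      using b_pow by (simp add: nat_pow_pow mult.commute[of s] flip: nat_pow_pow[of b p])
    show "a \<otimes> b [^] s = b [^] s \<otimes> a [^] (1 + p ^ (n - 2))"
      using rs unfolding a_pow_b_pow by (metis a_closed ord_a pow_eq_iff_cong)
    have "p dvd p ^ (n - 2)" using n by simp
    then show "[1 + p ^ (n - 2) = 1] (mod p)"
      by (simp only: cong_add_lcancel_0_nat cong_0_iff)
    show "[1 + p ^ (n - 2) = 1] (mod p ^ (n - 2))"
      by (simp only: cong_add_lcancel_0_nat cong_0_iff dvd_refl)
  qed simp
  then show ?thesis by (rule that)
qed

section \<open>The presented group: generators, normal form and order\<close>

lemma word_class_pow:
  "word_class R [(x, True)] [^]\<^bsub>presented_group R\<^esub> k = word_class R (gen_pow x k)"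
  by (induction k) (simp_all add: one_presented_group mult_presented_group replicate_append_same
    group.is_monoid[OF group_presented_group] monoid.nat_pow_Suc)

lemma word_class_inv:
  "word_class R [(x, False)] = inv\<^bsub>presented_group R\<^esub> (word_class R [(x, True)])"
proof -
  interpret group "presented_group R" by (rule group_presented_group)
  have "word_class R [(x, False)] \<otimes>\<^bsub>presented_group R\<^esub> word_class R [(x, True)] = \<one>\<^bsub>presented_group R\<^esub>"
    using word_eq_cancel[of R x False] by (simp add: mult_presented_group one_presented_group word_class_eq_iff)
  then show ?thesis by (intro inv_equality[symmetric]) (auto simp: carrier_presented_group)
qed

definition modular_a :: "nat \<Rightarrow> nat \<Rightarrow> gen_ab word set" where
  "modular_a p n = word_class (modular_rels p n) [(Gen_a, True)]"

definition modular_b :: "nat \<Rightarrow> nat \<Rightarrow> gen_ab word set" where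
  "modular_b p n = word_class (modular_rels p n) [(Gen_b, True)]"

lemma group_modular: "group (modular_group p n)"
  unfolding modular_group_def by (rule group_presented_group)

lemma modular_gens_closed:
  "modular_a p n \<in> carrier (modular_group p n)"
  "modular_b p n \<in> carrier (modular_group p n)"
  by (auto simp: modular_a_def modular_b_def modular_group_def carrier_presented_group)

lemma modular_relations:
  fixes p n :: nat
  defines "M \<equiv> modular_group p n" and "\<alpha> \<equiv> modular_a p n" and "\<beta> \<equiv> modular_b p n"
  shows "\<alpha> [^]\<^bsub>M\<^esub> (p ^ (n - 1)) = \<one>\<^bsub>M\<^esub>"
    "\<beta> [^]\<^bsub>M\<^esub> p = \<one>\<^bsub>M\<^esub>"
    "\<alpha> \<otimes>\<^bsub>M\<^esub> \<beta> = \<beta> \<otimes>\<^bsub>M\<^esub> \<alpha> [^]\<^bsub>M\<^esub> (1 + p ^ (n - 2))"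
proof -
  note cl = modular_gens_closed[of p n, folded M_def \<alpha>_def \<beta>_def]
  let ?R = "modular_rels p n"
  interpret group M unfolding M_def by (rule group_modular)
  have rel: "word_class ?R u = word_class ?R v" if "(u, v) \<in> ?R" for u v
    using that by (simp add: word_class_eq_iff word_eq_rel)
  show "\<alpha> [^]\<^bsub>M\<^esub> (p ^ (n - 1)) = \<one>\<^bsub>M\<^esub>"
    "\<beta> [^]\<^bsub>M\<^esub> p = \<one>\<^bsub>M\<^esub>"
    unfolding M_def \<alpha>_def \<beta>_def modular_a_def modular_b_def modular_group_def word_class_pow one_presented_group
    by (rule rel, simp add: modular_rels_def)+
  have "inv\<^bsub>M\<^esub> \<beta> \<otimes>\<^bsub>M\<^esub> (\<alpha> \<otimes>\<^bsub>M\<^esub> \<beta>) = \<alpha> [^]\<^bsub>M\<^esub> (1 + p ^ (n - 2))"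
    using rel[of "[(Gen_b, False), (Gen_a, True), (Gen_b, True)]" "gen_pow Gen_a (1 + p ^ (n - 2))"]
    unfolding M_def \<alpha>_def \<beta>_def modular_a_def modular_b_def modular_group_def word_class_pow word_class_inv[symmetric] mult_presented_group
    by (simp add: modular_rels_def)
  then show "\<alpha> \<otimes>\<^bsub>M\<^esub> \<beta> = \<beta> \<otimes>\<^bsub>M\<^esub> \<alpha> [^]\<^bsub>M\<^esub> (1 + p ^ (n - 2))"
    using cl by (metis inv_closed inv_solve_left m_closed nat_pow_closed)
qed

text \<open>The normal forms are a subgroup by \<open>metacyclic_subgroup\<close>; it contains the
  class of every letter and hence of every word.\<close>

lemma carrier_modular:
  fixes p n :: nat
  assumes p: "p > 0"
  defines "M \<equiv> modular_group p n" and "\<alpha> \<equiv> modular_a p n" and "\<beta> \<equiv> modular_b p n"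
  shows "carrier M = {\<beta> [^]\<^bsub>M\<^esub> (j::nat) \<otimes>\<^bsub>M\<^esub> \<alpha> [^]\<^bsub>M\<^esub> (k::nat) | j k. True}" (is "_ = ?S")
proof -
  note rels = modular_relations[where p = p and n = n, folded M_def \<alpha>_def \<beta>_def]
  note cl = modular_gens_closed[of p n, folded M_def \<alpha>_def \<beta>_def]
  let ?R = "modular_rels p n"
  interpret group M unfolding M_def by (rule group_modular)
  have S: "subgroup ?S M"
    by (rule metacyclic_subgroup[OF cl rels(1,2) _ p rels(3)]) (use p in simp)
  have "\<alpha> \<in> ?S"
    by (rule CollectI, rule exI[of _ 0], rule exI[of _ 1]) (simp add: cl)
  moreover have "\<beta> \<in> ?S"
    by (rule CollectI, rule exI[of _ 1], rule exI[of _ 0]) (simp add: cl)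
  ultimately have letter: "word_class ?R [(x, s)] \<in> ?S" for x s
    using subgroup.m_inv_closed[OF S] unfolding M_def \<alpha>_def \<beta>_def modular_a_def modular_b_def
    by (cases x; cases s) (simp_all add: word_class_inv flip: modular_group_def M_def)
  have "word_class ?R u \<in> ?S" for u
  proof (induction u)
    case Nil
    then show ?case
      using subgroup.one_closed[OF S] by (simp add: M_def modular_group_def one_presented_group)
  next
    case (Cons l u)
    have "word_class ?R [l] \<otimes>\<^bsub>M\<^esub> word_class ?R u \<in> ?S"
      using letter[of "fst l" "snd l"] Cons.IH subgroup.m_closed[OF S] by simp
    then show ?case by (simp add: M_def modular_group_def mult_presented_group)
  qed
  then have "carrier M \<subseteq> ?S"
    by (auto simp: M_def modular_group_def carrier_presented_group)
  then show ?thesis using subgroup.subset[OF S] by blast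
qed

text \<open>The bound keeps the order of \<open>\<alpha>\<close>, which the presentation alone might
  make smaller than \<open>p ^ (n - 1)\<close>. It is read in two ways: as
  \<open>card (carrier M) \<le> p ^ n\<close>, and, when the order is known to be
  \<open>p ^ n\<close>, as a proof that \<open>\<alpha>\<close> has full order.\<close>

lemma card_carrier_modular:
  fixes p n :: nat
  assumes p: "p > 0"
  defines "M \<equiv> modular_group p n" and "\<alpha> \<equiv> modular_a p n" and "\<beta> \<equiv> modular_b p n"
  shows "finite (carrier M)" "card (carrier M) \<le> p * group.ord M \<alpha>"
proof -
  note rels = modular_relations[where p = p and n = n, folded M_def \<alpha>_def \<beta>_def]
  note cl = modular_gens_closed[of p n, folded M_def \<alpha>_def \<beta>_def]
  interpret group M unfolding M_def by (rule group_modular)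
  have ord: "ord \<alpha> > 0"
    \<comment> \<open>\<open>ord\<close> is 0 for elements of infinite order; the first relation
      excludes this.\<close>
    using rels(1) cl p pow_eq_id[of \<alpha> "p ^ (n - 1)"]
    by (metis dvd_0_left_iff gr0I power_not_zero)
  show "finite (carrier M)" "card (carrier M) \<le> p * group.ord M \<alpha>"
    unfolding carrier_modular[OF p, of n, folded M_def \<alpha>_def \<beta>_def]
    using card_metacyclic_le[OF cl pow_ord_eq_1[OF cl(1)] rels(2) ord p]
    by auto
qed

text \<open>Von Dyck's theorem maps the presented group onto \<open>G\<close>, and its order is at
  most \<open>p ^ n\<close>. Thus \<open>G\<close> itself witnesses that the presentation does not
  collapse.\<close>

lemma (in split_cyclic_maximal) iso_modular_group:
  assumes r: "r = 1 + p ^ (n - 2)"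
  shows "G \<cong> modular_group p n"
proof -
  let ?M = "modular_group p n"
  interpret M: group ?M by (rule group_modular)
  define f where "f x = (case x of Gen_a \<Rightarrow> a | Gen_b \<Rightarrow> b)" for x
  have f: "f x \<in> carrier G" for x by (cases x) (auto simp: f_def)
  have ev: "word_eval G f (gen_pow x k) = f x [^] k" for x k
  proof (induction k)
    case (Suc k)
    then show ?case using nat_pow_Suc2[OF f, of x k] by simp
  qed simp
  have aN: "a [^] p ^ (n - 1) = \<one>" by (rule pow_eq_one) simp
  have "inv b \<otimes> (a \<otimes> b) = a [^] r"
    unfolding ab by (simp flip: m_assoc)
  then have rel: "word_eval G f u = word_eval G f v" if "(u, v) \<in> modular_rels p n" for u v
    using that aN b_pow unfolding modular_rels_def
    by (auto simp: ev r simp del: replicate_Suc) (auto simp: f_def)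
  obtain h where h: "h \<in> hom ?M G" "\<And>u. h (word_class (modular_rels p n) u) = word_eval G f u"
    using presented_group_hom_exists[OF group_axioms f rel] unfolding modular_group_def by blast
  interpret h: group_hom ?M G h by unfold_locales (rule h(1))
  note cl = modular_gens_closed[of p n]
  have hab: "h (modular_a p n) = a" "h (modular_b p n) = b"
    unfolding modular_a_def modular_b_def h(2) by (simp_all add: f_def)
  have "h ` carrier ?M = carrier G"
  proof
    show "carrier G \<subseteq> h ` carrier ?M"
    proof
      fix g assume "g \<in> carrier G"
      then obtain j k :: nat where g: "g = b [^] j \<otimes> a [^] k" by (rule exhaust)
      have "g = h (modular_b p n [^]\<^bsub>?M\<^esub> j \<otimes>\<^bsub>?M\<^esub> modular_a p n [^]\<^bsub>?M\<^esub> k)"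
        using cl by (simp add: g h.hom_nat_pow hab)
      then show "g \<in> h ` carrier ?M" using cl by blast
    qed
  qed auto
  moreover have "card (carrier ?M) \<le> card (carrier G)"
  proof -
    have "M.ord (modular_a p n) dvd p ^ (n - 1)"
      using modular_relations(1)[of p n] M.pow_eq_id[OF cl(1)] by simp
    then have "p * M.ord (modular_a p n) \<le> p * p ^ (n - 1)"
      using p_gt_0 by (simp add: dvd_imp_le)
    then show ?thesis
      using card_carrier_modular(2)[OF p_gt_0, of n] order_G unfolding order_def p_power_n(1)[symmetric]
      by simp
  qed
  ultimately have "?M \<cong> G"
    using h(1) card_carrier_modular(1)[OF p_gt_0] by (intro is_iso_if_surj_card_le)
  then show ?thesis by (rule M.iso_sym)
qed

text \<open>For \<open>n = 2\<close> the presentation contains a^b = a^2 and collapses to C_p, so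
  the second alternative is impossible; the argument by orders covers this without a separate
  case.\<close>

lemma (in noncyclic_p_group) exists_cyclic_maximal_iff:
  "(\<exists>x\<in>carrier G. ord x = p ^ (n - 1)) \<longleftrightarrow>
    G \<cong> integer_mod_group (p ^ (n - 1)) \<times>\<times> integer_mod_group p \<or> G \<cong> modular_group p n"
proof
  assume "\<exists>x\<in>carrier G. ord x = p ^ (n - 1)"
  then obtain a where a: "a \<in> carrier G" "ord a = p ^ (n - 1)" by blast
  interpret cyclic_maximal G p n a
    by unfold_locales (use a in auto)
  obtain b r where "split_cyclic_maximal G p n a b r" by (rule split)
  then interpret split_cyclic_maximal G p n a b r .
  show "G \<cong> integer_mod_group (p ^ (n - 1)) \<times>\<times> integer_mod_group p \<or> G \<cong> modular_group p n"
  proof (cases "a \<otimes> b = b \<otimes> a")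
    case True
    then show ?thesis using iso_direct_product_if_commute by blast
  next
    case False
    then obtain c where "split_cyclic_maximal G p n a c (1 + p ^ (n - 2))" by (rule modular_complement)
    then have "G \<cong> modular_group p n"
      by (rule split_cyclic_maximal.iso_modular_group[OF _ refl])
    then show ?thesis ..
  qed
next
  assume "G \<cong> integer_mod_group (p ^ (n - 1)) \<times>\<times> integer_mod_group p \<or> G \<cong> modular_group p n"
  then show "\<exists>x\<in>carrier G. ord x = p ^ (n - 1)"
  proof
    let ?D = "integer_mod_group (p ^ (n - 1)) \<times>\<times> integer_mod_group p"
    assume iso: "G \<cong> ?D"
    interpret D: group ?D by (simp add: DirProd_group)
    have pow: "(1, 0) [^]\<^bsub>?D\<^esub> k = (int k mod int (p ^ (n - 1)), 0)" for k :: nat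
    proof (induction k)
      case (Suc k)
      then show ?case using p_gt_0 by (simp add: mod_add_right_eq add.commute)
    qed simp
    \<comment> \<open>The residue 1 belongs to the carrier of the first factor only if the modulus
      exceeds 1.\<close>
    have "p ^ (n - 1) \<noteq> 1" using p_gt_1 n_ge_2 by simp
    then have x: "(1, 0) \<in> carrier ?D" by (simp only: carrier_DirProd) simp
    have "D.ord (1, 0) = p ^ (n - 1)"
      unfolding D.ord_unique[OF x] pow by (auto simp: mod_eq_0_iff_dvd simp del: of_nat_power)
    then show ?thesis
      using exists_ord_iso[OF group_axioms D.is_group iso] x by blast
  next
    let ?M = "modular_group p n"
    assume iso: "G \<cong> ?M"
    interpret M: group ?M by (rule group_modular)
    note cl = modular_gens_closed[of p n]
    have "card (carrier ?M) = p ^ n"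
      using iso_same_card[OF iso] order_G by (simp add: order_def)
    then have "p ^ (n - 1) \<le> M.ord (modular_a p n)"
      using card_carrier_modular(2)[OF p_gt_0, of n] p_gt_0 unfolding p_power_n(1) by simp
    moreover have "M.ord (modular_a p n) dvd p ^ (n - 1)"
      using modular_relations(1)[of p n] M.pow_eq_id[OF cl(1)] by simp
    then have "M.ord (modular_a p n) \<le> p ^ (n - 1)"
      using p_gt_0 by (simp add: dvd_imp_le)
    ultimately have "M.ord (modular_a p n) = p ^ (n - 1)" by simp
    then show ?thesis
      using exists_ord_iso[OF group_axioms M.is_group iso] cl(1) by blast
  qed
qed

theorem theorem1:
  fixes G :: "('a, 'b) monoid_scheme" and p n :: nat
  assumes "Factorial_Ring.prime p" and "odd p"
    and "group G" and "order G = p ^ n"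
    and "\<not> G \<cong> integer_mod_group (p ^ n)"
  shows "card (subgroups_of G) \<ge> (p + 1) * (n - 1) + 2 \<and>
    (card (subgroups_of G) = (p + 1) * (n - 1) + 2 \<longleftrightarrow>
      G \<cong> integer_mod_group (p ^ (n - 1)) \<times>\<times> integer_mod_group p \<or>
      G \<cong> modular_group p n)"
proof -
  interpret group G by fact
  have fin: "finite (carrier G)"
    using assms(1,4) by (simp add: prime_gt_0_nat flip: order_gt_0_iff_finite)
  interpret noncyclic_p_group G p n
  proof unfold_locales
    show "ord x \<noteq> p ^ n" if "x \<in> carrier G" for x
      using iso_integer_mod_group[OF fin that] assms(4,5) by auto
  qed (use assms in auto)
  \<comment> \<open>The image under \<open>id\<close> forgets possible further record fields of
    \<open>G\<close>, as the count is stated for plain monoids.\<close>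
  have iso: "G \<cong> image_group id G" and H: "group (image_group id G)"
    using inj_imp_image_group_iso[of id G] inj_imp_image_group_is_group[of id] by (auto intro: is_isoI)
  have "noncyclic_p_group (image_group id G) p n"
    by (rule noncyclic_p_group_iso[OF noncyclic_p_group_axioms H iso])
  from noncyclic_p_group_card_subgroups[OF this] show ?thesis
    unfolding exists_ord_iso[OF group_axioms H iso, symmetric] exists_cyclic_maximal_iff
      card_subgroups_of_iso[OF group_axioms H fin iso, symmetric] .
qed

end
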